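(* Let $R$ be a nonzero unital commutative ring, let $G$ be a group with identity $e$, and let $\mathcal{R}$ be a set of relations on the set $\{\varepsilon_g : g\in G\}$. For each $g\in G$, let $D_g = A_{\operatorname{par}}(G,\mathcal{R})\varepsilon_g$, and define $\theta_g:D_{g^{-1}}\to D_g$ (as an $R$-algebra homomorphism) by $\theta_g(\varepsilon_h\varepsilon_{g^{-1}}) = \varepsilon_{gh}\varepsilon_g$ for all $h\in G$. Then $\theta=(\{D_g\}_{g\in G},\{\theta_g\}_{g\in G})$ defines a partial action of $G$ on $A_{\operatorname{par}}(G,\mathcal{R})$. Moreover, the map $$R_{\operatorname{par}}(G,\mathcal{R}) \to A_{\operatorname{par}}(G,\mathcal{R})\rtimes_\theta G,\qquad [g] \mapsto \varepsilon_g\delta_g,$$ is an isomorphism of $R$-algebras.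
   Context: $R_{\operatorname{par}}(G,\mathcal{R})$ is the universal unital $R$-algebra with generators $\{[g]: g\in G\}$ subject to the relations, for all $g,h\in G$: (i) $[e]=1$; (ii) $[g^{-1}][g][h]=[g^{-1}][gh]$; (iii) $[g][h][h^{-1}]=[gh][h^{-1}]$; together with the relations in $\mathcal{R}$. Here $\varepsilon_g:=[g][g^{-1}]$, and a set of relations $\mathcal{R}$ on $\{\varepsilon_g:g\in G\}$ is a set of relations each of the form $\sum_i\lambda_i\prod_j\varepsilon_{g_{ij}}=0$ (finite sums and products, $\lambda_i\in R$, $g_{ij}\in G$). $A_{\operatorname{par}}(G,\mathcal{R})$ is the $R$-subalgebra of $R_{\operatorname{par}}(G,\mathcal{R})$ generated by $\{\varepsilon_g:g\in G\}$; the $\varepsilon_g$ are commuting idempotents, so this algebra is commutative. A partial action of $G$ on an $R$-algebra $A$ is a family of ideals $D_g\subseteq A$ and $R$-algebra isomorphisms $\theta_g:D_{g^{-1}}\to D_g$ such that $D_e=A$, $\theta_e=\mathrm{id}$, $\theta_g(D_{g^{-1}}\cap D_h)\subseteq D_{gh}$ and $\theta_g\theta_h(x)=\theta_{gh}(x)$ for $x\in D_{h^{-1}}\cap D_{(gh)^{-1}}$. The partial skew group ring $A\rtimes_\theta G$ is $\bigoplus_{g\in G}D_g\delta_g$ with product $(a\delta_g)(b\delta_h)=\theta_g(\theta_{g^{-1}}(a)b)\delta_{gh}$. *)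

theory Defs
  imports "HOL-Algebra.Module" "HOL-Algebra.QuotRing" "HOL-Algebra.Subrings"
begin

section \<open>Algebras over a commutative ring\<close>

text \<open>The library locale \<open>algebra\<close> requires the algebra to be commutative; here algebras are
  associative and unital, but not necessarily commutative.\<close>

locale r_algebra = module R A + ring A for R (structure) and A (structure) +
  assumes smult_mult_left:
      "\<lbrakk>r \<in> carrier R; x \<in> carrier A; y \<in> carrier A\<rbrakk> \<Longrightarrow>
        (r \<odot>\<^bsub>A\<^esub> x) \<otimes>\<^bsub>A\<^esub> y = r \<odot>\<^bsub>A\<^esub> (x \<otimes>\<^bsub>A\<^esub> y)"
    and smult_mult_right:
      "\<lbrakk>r \<in> carrier R; x \<in> carrier A; y \<in> carrier A\<rbrakk> \<Longrightarrow>
        x \<otimes>\<^bsub>A\<^esub> (r \<odot>\<^bsub>A\<^esub> y) = r \<odot>\<^bsub>A\<^esub> (x \<otimes>\<^bsub>A\<^esub> y)"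

text \<open>Homomorphisms which need not preserve the unit: ideals, with their carrier substituted into
  the record of the ambient algebra, are not unital subalgebras of it.\<close>

definition alg_hom ::
    "('r, 'p) ring_scheme \<Rightarrow> ('r, 'a, 'q) module_scheme \<Rightarrow> ('r, 'b, 's) module_scheme \<Rightarrow> ('a \<Rightarrow> 'b) set"
  where "alg_hom R A B = {f \<in> carrier A \<rightarrow> carrier B.
    (\<forall>x\<in>carrier A. \<forall>y\<in>carrier A. f (x \<oplus>\<^bsub>A\<^esub> y) = f x \<oplus>\<^bsub>B\<^esub> f y) \<and>
    (\<forall>x\<in>carrier A. \<forall>y\<in>carrier A. f (x \<otimes>\<^bsub>A\<^esub> y) = f x \<otimes>\<^bsub>B\<^esub> f y) \<and>
    (\<forall>r\<in>carrier R. \<forall>x\<in>carrier A. f (r \<odot>\<^bsub>A\<^esub> x) = r \<odot>\<^bsub>B\<^esub> f x)}"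

definition unital_alg_hom ::
    "('r, 'p) ring_scheme \<Rightarrow> ('r, 'a, 'q) module_scheme \<Rightarrow> ('r, 'b, 's) module_scheme \<Rightarrow> ('a \<Rightarrow> 'b) set"
  where "unital_alg_hom R A B = {f \<in> alg_hom R A B. f \<one>\<^bsub>A\<^esub> = \<one>\<^bsub>B\<^esub>}"

definition unital_alg_iso ::
    "('r, 'p) ring_scheme \<Rightarrow> ('r, 'a, 'q) module_scheme \<Rightarrow> ('r, 'b, 's) module_scheme \<Rightarrow> ('a \<Rightarrow> 'b) set"
  where "unital_alg_iso R A B = {f \<in> unital_alg_hom R A B.
    r_algebra R A \<and> r_algebra R B \<and> bij_betw f (carrier A) (carrier B)}"

definition generated_subalgebra ::
    "('r, 'p) ring_scheme \<Rightarrow> ('r, 'a, 'q) module_scheme \<Rightarrow> 'a set \<Rightarrow> 'a set"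
  where "generated_subalgebra R A S = \<Inter>{B. subring B A \<and> submodule B R A \<and> S \<subseteq> B}"

text \<open>A two-sided ideal \<open>I\<close> of a unital \<open>R\<close>-algebra is automatically closed under scalars.\<close>

definition quotient_algebra :: "('r, 'a, 'q) module_scheme \<Rightarrow> 'a set \<Rightarrow> ('r, 'a set) module"
  where "quotient_algebra A I = \<lparr>carrier = carrier (A Quot I), monoid.mult = monoid.mult (A Quot I),
    one = one (A Quot I), zero = zero (A Quot I), add = add (A Quot I),
    smult = (\<lambda>r C. \<Union>x\<in>C. I +>\<^bsub>A\<^esub> (r \<odot>\<^bsub>A\<^esub> x))\<rparr>"


section \<open>Free unital algebras\<close>

text \<open>Elements are finitely supported functions on words; the function \<open>f\<close> stands for
  the sum of the \<open>f w\<close> times \<open>w\<close>.\<close>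

definition free_algebra :: "('r, 'p) ring_scheme \<Rightarrow> 'x set \<Rightarrow> ('r, 'x list \<Rightarrow> 'r) module"
  where "free_algebra R B =
    \<lparr>carrier = {f. f \<in> lists B \<rightarrow> carrier R \<and> (\<forall>w. w \<notin> lists B \<longrightarrow> f w = \<zero>\<^bsub>R\<^esub>) \<and>
                   finite {w. f w \<noteq> \<zero>\<^bsub>R\<^esub>}},
     monoid.mult = (\<lambda>f f' w. finsum R (\<lambda>(u, v). f u \<otimes>\<^bsub>R\<^esub> f' v) {(u, v). u @ v = w}),
     one = (\<lambda>w. if w = [] then \<one>\<^bsub>R\<^esub> else \<zero>\<^bsub>R\<^esub>),
     zero = (\<lambda>w. \<zero>\<^bsub>R\<^esub>),
     add = (\<lambda>f f' w. f w \<oplus>\<^bsub>R\<^esub> f' w),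
     smult = (\<lambda>r f w. r \<otimes>\<^bsub>R\<^esub> f w)\<rparr>"

definition free_gen :: "('r, 'p) ring_scheme \<Rightarrow> 'x \<Rightarrow> 'x list \<Rightarrow> 'r"
  where "free_gen R x = (\<lambda>w. if w = [x] then \<one>\<^bsub>R\<^esub> else \<zero>\<^bsub>R\<^esub>)"


section \<open>The algebras \<open>R\<^sub>p\<^sub>a\<^sub>r(G, \<R>)\<close> and \<open>A\<^sub>p\<^sub>a\<^sub>r(G, \<R>)\<close>\<close>

text \<open>A relation \<open>\<Sum>\<^sub>i \<lambda>\<^sub>i \<Prod>\<^sub>j \<epsilon>(g\<^sub>i\<^sub>j) = 0\<close> is encoded by the list of the pairs
  \<open>(\<lambda>\<^sub>i, [g\<^sub>i\<^sub>1, g\<^sub>i\<^sub>2, \<dots>])\<close>. Empty products are allowed and denote 1.\<close>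

type_synonym ('r, 'g) eps_relation = "('r \<times> 'g list) list"

definition relations_on_eps ::
    "('r, 'p) ring_scheme \<Rightarrow> ('g, 'q) monoid_scheme \<Rightarrow> ('r, 'g) eps_relation set \<Rightarrow> bool"
  where "relations_on_eps R G rels \<longleftrightarrow> rels \<subseteq> lists (carrier R \<times> lists (carrier G))"

definition eval_relation ::
    "('r, 'a, 'p) module_scheme \<Rightarrow> ('g \<Rightarrow> 'a) \<Rightarrow> ('r, 'g) eps_relation \<Rightarrow> 'a"
  where "eval_relation A \<epsilon> rel =
    foldr (\<lambda>(c, gs) s. (c \<odot>\<^bsub>A\<^esub> foldr (\<lambda>g p. \<epsilon> g \<otimes>\<^bsub>A\<^esub> p) gs \<one>\<^bsub>A\<^esub>) \<oplus>\<^bsub>A\<^esub> s) rel \<zero>\<^bsub>A\<^esub>"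

text \<open>The elements of the free algebra on \<open>G\<close> that are set to zero.\<close>

definition par_relators ::
    "('r, 'p) ring_scheme \<Rightarrow> ('g, 'q) monoid_scheme \<Rightarrow> ('r, 'g) eps_relation set \<Rightarrow> ('g list \<Rightarrow> 'r) set"
  where "par_relators R G rels =
   (let F = free_algebra R (carrier G); b = free_gen R in
      {b \<one>\<^bsub>G\<^esub> \<ominus>\<^bsub>F\<^esub> \<one>\<^bsub>F\<^esub>}
    \<union> {(b (inv\<^bsub>G\<^esub> g) \<otimes>\<^bsub>F\<^esub> b g \<otimes>\<^bsub>F\<^esub> b h) \<ominus>\<^bsub>F\<^esub> (b (inv\<^bsub>G\<^esub> g) \<otimes>\<^bsub>F\<^esub> b (g \<otimes>\<^bsub>G\<^esub> h)) | g h.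
          g \<in> carrier G \<and> h \<in> carrier G}
    \<union> {(b g \<otimes>\<^bsub>F\<^esub> b h \<otimes>\<^bsub>F\<^esub> b (inv\<^bsub>G\<^esub> h)) \<ominus>\<^bsub>F\<^esub> (b (g \<otimes>\<^bsub>G\<^esub> h) \<otimes>\<^bsub>F\<^esub> b (inv\<^bsub>G\<^esub> h)) | g h.
          g \<in> carrier G \<and> h \<in> carrier G}
    \<union> eval_relation F (\<lambda>g. b g \<otimes>\<^bsub>F\<^esub> b (inv\<^bsub>G\<^esub> g)) ` rels)"

definition R_par ::
    "('r, 'p) ring_scheme \<Rightarrow> ('g, 'q) monoid_scheme \<Rightarrow> ('r, 'g) eps_relation set \<Rightarrow>
      ('r, ('g list \<Rightarrow> 'r) set) module"
  where "R_par R G rels =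
    quotient_algebra (free_algebra R (carrier G))
      (Idl\<^bsub>free_algebra R (carrier G)\<^esub> (par_relators R G rels))"

definition par_gen ::
    "('r, 'p) ring_scheme \<Rightarrow> ('g, 'q) monoid_scheme \<Rightarrow> ('r, 'g) eps_relation set \<Rightarrow> 'g \<Rightarrow>
      ('g list \<Rightarrow> 'r) set"
  where "par_gen R G rels g =
    (Idl\<^bsub>free_algebra R (carrier G)\<^esub> (par_relators R G rels))
      +>\<^bsub>free_algebra R (carrier G)\<^esub> free_gen R g"

definition par_eps ::
    "('r, 'p) ring_scheme \<Rightarrow> ('g, 'q) monoid_scheme \<Rightarrow> ('r, 'g) eps_relation set \<Rightarrow> 'g \<Rightarrow>
      ('g list \<Rightarrow> 'r) set"
  where "par_eps R G rels g =
    par_gen R G rels g \<otimes>\<^bsub>R_par R G rels\<^esub> par_gen R G rels (inv\<^bsub>G\<^esub> g)"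

definition A_par ::
    "('r, 'p) ring_scheme \<Rightarrow> ('g, 'q) monoid_scheme \<Rightarrow> ('r, 'g) eps_relation set \<Rightarrow>
      ('r, ('g list \<Rightarrow> 'r) set) module"
  where "A_par R G rels = (R_par R G rels)\<lparr>carrier :=
    generated_subalgebra R (R_par R G rels) (par_eps R G rels ` carrier G)\<rparr>"


section \<open>Partial actions and partial skew group rings\<close>

definition partial_action ::
    "('r, 'p) ring_scheme \<Rightarrow> ('g, 'q) monoid_scheme \<Rightarrow> ('r, 'a, 's) module_scheme \<Rightarrow>
      ('g \<Rightarrow> 'a set) \<Rightarrow> ('g \<Rightarrow> 'a \<Rightarrow> 'a) \<Rightarrow> bool"
  where "partial_action R G A D \<theta> \<longleftrightarrow>
    r_algebra R A \<and>
    (\<forall>g\<in>carrier G. ideal (D g) A) \<and>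
    (\<forall>g\<in>carrier G. \<theta> g \<in> alg_hom R (A\<lparr>carrier := D (inv\<^bsub>G\<^esub> g)\<rparr>) (A\<lparr>carrier := D g\<rparr>) \<and>
                   bij_betw (\<theta> g) (D (inv\<^bsub>G\<^esub> g)) (D g)) \<and>
    D \<one>\<^bsub>G\<^esub> = carrier A \<and>
    (\<forall>x\<in>carrier A. \<theta> \<one>\<^bsub>G\<^esub> x = x) \<and>
    (\<forall>g\<in>carrier G. \<forall>h\<in>carrier G. \<theta> g ` (D (inv\<^bsub>G\<^esub> g) \<inter> D h) \<subseteq> D (g \<otimes>\<^bsub>G\<^esub> h)) \<and>
    (\<forall>g\<in>carrier G. \<forall>h\<in>carrier G. \<forall>x \<in> D (inv\<^bsub>G\<^esub> h) \<inter> D (inv\<^bsub>G\<^esub> (g \<otimes>\<^bsub>G\<^esub> h)).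
       \<theta> g (\<theta> h x) = \<theta> (g \<otimes>\<^bsub>G\<^esub> h) x)"

text \<open>The element \<open>\<Sum>\<^sub>g a\<^sub>g \<delta>\<^sub>g\<close> of the direct sum is the finitely supported function \<open>g \<mapsto> a\<^sub>g\<close>,
  extended by zero outside the carrier of \<open>G\<close>. The multiplication is the biadditive extension of
  \<open>(a \<delta>\<^sub>g) (b \<delta>\<^sub>h) = \<theta>\<^sub>g (\<theta>\<^sub>g\<^sub>-\<^sub>1 (a) b) \<delta>\<^sub>g\<^sub>h\<close>. The field \<open>one\<close> is \<open>1 \<delta>\<^sub>e\<close>.\<close>

definition skew_elem :: "('r, 'a, 's) module_scheme \<Rightarrow> 'a \<Rightarrow> 'g \<Rightarrow> 'g \<Rightarrow> 'a"
  where "skew_elem A a g = (\<lambda>k. if k = g then a else \<zero>\<^bsub>A\<^esub>)"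

definition partial_skew_group_ring ::
    "('g, 'q) monoid_scheme \<Rightarrow> ('r, 'a, 's) module_scheme \<Rightarrow>
      ('g \<Rightarrow> 'a set) \<Rightarrow> ('g \<Rightarrow> 'a \<Rightarrow> 'a) \<Rightarrow> ('r, 'g \<Rightarrow> 'a) module"
  where "partial_skew_group_ring G A D \<theta> =
    \<lparr>carrier = {f. (\<forall>g\<in>carrier G. f g \<in> D g) \<and> (\<forall>g. g \<notin> carrier G \<longrightarrow> f g = \<zero>\<^bsub>A\<^esub>) \<and>
                   finite {g. f g \<noteq> \<zero>\<^bsub>A\<^esub>}},
     monoid.mult = (\<lambda>f f' k. finsum A (\<lambda>(g, h). \<theta> g (\<theta> (inv\<^bsub>G\<^esub> g) (f g) \<otimes>\<^bsub>A\<^esub> f' h))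
                {(g, h). g \<in> carrier G \<and> h \<in> carrier G \<and> f g \<noteq> \<zero>\<^bsub>A\<^esub> \<and> f' h \<noteq> \<zero>\<^bsub>A\<^esub> \<and> g \<otimes>\<^bsub>G\<^esub> h = k}),
     one = skew_elem A \<one>\<^bsub>A\<^esub> \<one>\<^bsub>G\<^esub>,
     zero = (\<lambda>g. \<zero>\<^bsub>A\<^esub>),
     add = (\<lambda>f f' g. f g \<oplus>\<^bsub>A\<^esub> f' g),
     smult = (\<lambda>r f g. r \<odot>\<^bsub>A\<^esub> f g)\<rparr>"


section \<open>The partial action on \<open>A\<^sub>p\<^sub>a\<^sub>r(G, \<R>)\<close>\<close>

definition par_ideal ::
    "('r, 'p) ring_scheme \<Rightarrow> ('g, 'q) monoid_scheme \<Rightarrow> ('r, 'g) eps_relation set \<Rightarrow> 'g \<Rightarrow>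
      ('g list \<Rightarrow> 'r) set set"
  where "par_ideal R G rels g =
    {a \<otimes>\<^bsub>A_par R G rels\<^esub> par_eps R G rels g | a. a \<in> carrier (A_par R G rels)}"

text \<open>\<open>par_theta R G rels g\<close> is the set of all maps satisfying the defining conditions of \<open>\<theta>\<^sub>g\<close>;
  values outside \<open>D\<^sub>g\<^sub>-\<^sub>1\<close> are unconstrained.\<close>

definition par_theta ::
    "('r, 'p) ring_scheme \<Rightarrow> ('g, 'q) monoid_scheme \<Rightarrow> ('r, 'g) eps_relation set \<Rightarrow> 'g \<Rightarrow>
      (('g list \<Rightarrow> 'r) set \<Rightarrow> ('g list \<Rightarrow> 'r) set) set"
  where "par_theta R G rels g =
    {\<phi> \<in> alg_hom R ((A_par R G rels)\<lparr>carrier := par_ideal R G rels (inv\<^bsub>G\<^esub> g)\<rparr>)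
                    ((A_par R G rels)\<lparr>carrier := par_ideal R G rels g\<rparr>).
      \<forall>h\<in>carrier G.
        \<phi> (par_eps R G rels h \<otimes>\<^bsub>A_par R G rels\<^esub> par_eps R G rels (inv\<^bsub>G\<^esub> g)) =
        par_eps R G rels (g \<otimes>\<^bsub>G\<^esub> h) \<otimes>\<^bsub>A_par R G rels\<^esub> par_eps R G rels g}"

end

theory Submission
  imports Defs
begin

text \<open>Conjugation \<open>x \<mapsto> [g] x [g\<^sup>-\<^sup>1]\<close> maps \<open>\<epsilon>\<^sub>h \<epsilon>\<^sub>g\<^sub>-\<^sub>1\<close> to \<open>\<epsilon>\<^sub>g\<^sub>h \<epsilon>\<^sub>g\<close>, so it is \<open>\<theta>\<^sub>g\<close>; since it lives inside
  \<open>R\<^sub>p\<^sub>a\<^sub>r(G, \<R>)\<close>, no compatibility of \<open>\<R>\<close> with the action has to be checked. The inverse of the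
  isomorphism is \<open>\<Psi>: \<Sum> a\<^sub>g \<delta>\<^sub>g \<mapsto> \<Sum> a\<^sub>g [g]\<close>. It is multiplicative and hits the generators.
  All relators are homogeneous for the \<open>G\<close>-grading of the free algebra in which a word has its product as
  degree, so \<open>R\<^sub>p\<^sub>a\<^sub>r(G, \<R>)\<close> is \<open>G\<close>-graded with \<open>a\<^sub>g [g]\<close> in degree \<open>g\<close>; since \<open>a\<^sub>g [g] [g\<^sup>-\<^sup>1] = a\<^sub>g\<close> for
  \<open>a\<^sub>g \<in> D\<^sub>g\<close>, this makes \<open>\<Psi>\<close> injective. Associativity of the partial skew group ring is transported
  along \<open>\<Psi>\<close>.\<close>

section \<open>Finite sums and algebras\<close>

text \<open>The obstacle is that [g] |-> eps_g delta_g cannot be checked directly: a homomorphism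
  out of a presented algebra needs an associative target, and associativity of the skew product is
  the laborious part. The sum of the a_g [g], in contrast, makes sense before any law of the skew
  ring is known, and once it is injective and multiplicative it supplies those laws. Its injectivity
  cannot be tested by a homomorphism into the skew ring, for the same reason, so it has to come from
  inside \<open>R_par\<close>; this is what the grading is for. Multiplicativity comes down to (a
  [g])(b [h]) = a ([g] b [g^-1]) [gh] for a and b in \<open>A_par\<close>: the skew product is the
  product of \<open>R_par\<close> read on elements of the form a [g]. Since a map in
  \<open>par_theta\<close> is free outside D_(g^-1), the results are proved for every theta that
  agrees with conjugation on these ideals. Every admissible theta does so, because the products
  eps_h eps_(g^-1) generate D_(g^-1) as an algebra, its unit being the case h = e.\<close>

lemma (in abelian_monoid) finsum_single:
  assumes "finite X" "i \<in> X" "f i \<in> carrier G" "\<And>j. j \<in> X \<Longrightarrow> j \<noteq> i \<Longrightarrow> f j = \<zero>"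
  shows "finsum G f X = f i"
proof -
  have "finsum G f {i} = finsum G f X"
    using assms by (intro add.finprod_mono_neutral_cong_left) (auto, metis zero_closed)
  then show ?thesis
    using assms by (simp add: finsum_insert finsum_empty)
qed

text \<open>The inner index set may depend on the outer index; associativity in the free algebra
  needs this, where a part of a splitting is split again.\<close>

lemma (in abelian_monoid) finsum_Sigma:
  assumes "finite I" "\<And>i. i \<in> I \<Longrightarrow> finite (B i)"
    and "\<And>i j. i \<in> I \<Longrightarrow> j \<in> B i \<Longrightarrow> f i j \<in> carrier G"
  shows "(\<Oplus>i\<in>I. \<Oplus>j\<in>B i. f i j) = finsum G (\<lambda>(i, j). f i j) (Sigma I B)"
  using assms
proof (induction I rule: finite_induct)
  case empty
  then show ?case by simp
next
  case (insert i I)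
  have eq: "Sigma (insert i I) B = Pair i ` B i \<union> Sigma I B"
    by auto
  have "finsum G (\<lambda>(i, j). f i j) (Sigma (insert i I) B)
      = finsum G (\<lambda>(i, j). f i j) (Pair i ` B i) \<oplus> finsum G (\<lambda>(i, j). f i j) (Sigma I B)"
    unfolding eq using insert by (intro finsum_Un_disjoint) auto
  also have "finsum G (\<lambda>(i, j). f i j) (Pair i ` B i) = (\<Oplus>j\<in>B i. f i j)"
    using insert by (subst finsum_reindex) (auto simp: inj_on_def)
  finally show ?case
    using insert by (simp add: Pi_def)
qed

text \<open>Regroups a sum over pairs of group elements by their product, which is how coefficients
  of a product in the skew group ring are indexed.\<close>

lemma (in abelian_monoid) finsum_fibres:
  assumes "finite X" "finite K" "\<phi> ` X \<subseteq> K" "f \<in> X \<rightarrow> carrier G"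
  shows "(\<Oplus>k\<in>K. \<Oplus>x\<in>{x \<in> X. \<phi> x = k}. f x) = (\<Oplus>x\<in>X. f x)"
proof -
  have X: "X = (\<Union>k\<in>K. {x \<in> X. \<phi> x = k})"
    using assms(3) by auto
  show ?thesis
    using assms by (subst (2) X, subst add.finprod_UN_disjoint) (auto simp: pairwise_def disjnt_def)
qed

text \<open>Products in the skew group ring are sums in \<open>A_par\<close>, while
  \<open>\<Psi>\<close> sums in \<open>R_par\<close>; this reconciles the two.\<close>

lemma (in abelian_monoid) finsum_subcarrier:
  assumes "abelian_monoid (G\<lparr>carrier := B\<rparr>)" "B \<subseteq> carrier G" "f \<in> X \<rightarrow> B"
  shows "finsum (G\<lparr>carrier := B\<rparr>) f X = finsum G f X"
proof -
  interpret B: abelian_monoid "G\<lparr>carrier := B\<rparr>" by fact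
  show ?thesis
    using assms(3)
  proof (induction X rule: infinite_finite_induct)
    case (insert x X)
    then have "f \<in> X \<rightarrow> carrier G" "f x \<in> carrier G"
      using assms(2) by auto
    with insert show ?case
      by (simp add: B.finsum_insert)
  qed (simp_all add: B.finsum_infinite finsum_infinite B.finsum_empty)
qed

text \<open>Additive inverses need not be mentioned: they are obtained by scaling with -1.\<close>

lemma r_algebra_pullback:
  assumes "r_algebra R A" and f: "f \<in> carrier B \<rightarrow> carrier A" "inj_on f (carrier B)"
    and closed: "\<zero>\<^bsub>B\<^esub> \<in> carrier B" "\<one>\<^bsub>B\<^esub> \<in> carrier B"
      "\<And>x y. x \<in> carrier B \<Longrightarrow> y \<in> carrier B \<Longrightarrow> x \<oplus>\<^bsub>B\<^esub> y \<in> carrier B"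
      "\<And>x y. x \<in> carrier B \<Longrightarrow> y \<in> carrier B \<Longrightarrow> x \<otimes>\<^bsub>B\<^esub> y \<in> carrier B"
      "\<And>r x. r \<in> carrier R \<Longrightarrow> x \<in> carrier B \<Longrightarrow> r \<odot>\<^bsub>B\<^esub> x \<in> carrier B"
    and hom: "f \<zero>\<^bsub>B\<^esub> = \<zero>\<^bsub>A\<^esub>" "f \<one>\<^bsub>B\<^esub> = \<one>\<^bsub>A\<^esub>"
      "\<And>x y. x \<in> carrier B \<Longrightarrow> y \<in> carrier B \<Longrightarrow> f (x \<oplus>\<^bsub>B\<^esub> y) = f x \<oplus>\<^bsub>A\<^esub> f y"
      "\<And>x y. x \<in> carrier B \<Longrightarrow> y \<in> carrier B \<Longrightarrow> f (x \<otimes>\<^bsub>B\<^esub> y) = f x \<otimes>\<^bsub>A\<^esub> f y"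
      "\<And>r x. r \<in> carrier R \<Longrightarrow> x \<in> carrier B \<Longrightarrow> f (r \<odot>\<^bsub>B\<^esub> x) = r \<odot>\<^bsub>A\<^esub> f x"
  shows "r_algebra R B"
proof -
  interpret A: r_algebra R A by fact
  have fc: "f x \<in> carrier A" if "x \<in> carrier B" for x
    using f that by auto
  have eqI: "x = y" if "f x = f y" "x \<in> carrier B" "y \<in> carrier B" for x y
    using f that by (auto dest: inj_onD)
  note [simp] = fc closed hom
  have ag: "abelian_group B"
  proof (rule abelian_groupI)
    fix x assume x: "x \<in> carrier B"
    have "(\<ominus>\<^bsub>R\<^esub> \<one>\<^bsub>R\<^esub>) \<odot>\<^bsub>B\<^esub> x \<oplus>\<^bsub>B\<^esub> x = \<zero>\<^bsub>B\<^esub>"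
      using x by (intro eqI) (simp_all add: A.smult_l_minus A.M.l_neg)
    then show "\<exists>y\<in>carrier B. y \<oplus>\<^bsub>B\<^esub> x = \<zero>\<^bsub>B\<^esub>"
      using x by (intro bexI[of _ "(\<ominus>\<^bsub>R\<^esub> \<one>\<^bsub>R\<^esub>) \<odot>\<^bsub>B\<^esub> x"]) auto
  qed (auto intro!: eqI simp: A.M.a_assoc A.M.a_comm A.M.a_lcomm)
  have "monoid B"
    by (rule monoidI) (auto intro!: eqI simp: A.m_assoc)
  then have "ring B"
    by (intro ringI ag) (auto intro!: eqI simp: A.l_distr A.r_distr)
  moreover have "module R B"
    by (rule moduleI[OF A.R.is_cring ag])
      (auto intro!: eqI simp: A.smult_l_distr A.smult_r_distr A.smult_assoc1)
  moreover have "r_algebra_axioms R B"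
    by unfold_locales (auto intro!: eqI simp: A.smult_mult_left A.smult_mult_right)
  ultimately show ?thesis
    by (intro r_algebra.intro)
qed

text \<open>Transport of the laws along a surjection, for quotients. The homomorphism equations
  point towards images of \<open>f\<close> because every element of \<open>B\<close> is replaced by
  an image.\<close>

lemma r_algebra_image:
  assumes "r_algebra R A" and f: "f ` carrier A = carrier B"
    and hom: "f \<zero>\<^bsub>A\<^esub> = \<zero>\<^bsub>B\<^esub>" "f \<one>\<^bsub>A\<^esub> = \<one>\<^bsub>B\<^esub>"
      "\<And>x y. x \<in> carrier A \<Longrightarrow> y \<in> carrier A \<Longrightarrow> f x \<oplus>\<^bsub>B\<^esub> f y = f (x \<oplus>\<^bsub>A\<^esub> y)"
      "\<And>x y. x \<in> carrier A \<Longrightarrow> y \<in> carrier A \<Longrightarrow> f x \<otimes>\<^bsub>B\<^esub> f y = f (x \<otimes>\<^bsub>A\<^esub> y)"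
      "\<And>r x. r \<in> carrier R \<Longrightarrow> x \<in> carrier A \<Longrightarrow> r \<odot>\<^bsub>B\<^esub> f x = f (r \<odot>\<^bsub>A\<^esub> x)"
  shows "r_algebra R B"
proof -
  interpret A: r_algebra R A by fact
  \<comment> \<open>The constants of \<open>B\<close> are to become images too, so the equations for
    zero and one are used from right to left; their forward versions are deleted in each call, as
    the simplifier would loop.\<close>
  note [simp] = f[symmetric] hom hom(1,2)[symmetric]
  have ag: "abelian_group B"
  proof (rule abelian_groupI)
    fix y assume "y \<in> carrier B"
    then obtain x where x: "x \<in> carrier A" "y = f x" by auto
    then show "\<exists>z\<in>carrier B. z \<oplus>\<^bsub>B\<^esub> y = \<zero>\<^bsub>B\<^esub>"
      by (intro bexI[of _ "f (\<ominus>\<^bsub>A\<^esub> x)"]) (auto simp: A.M.l_neg simp del: hom(1) hom(2))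
  qed (auto simp: A.M.a_assoc A.M.a_comm A.M.a_lcomm simp del: hom(1,2))
  have "monoid B"
    by (rule monoidI) (auto simp: A.m_assoc simp del: hom(1,2))
  then have "ring B"
    by (intro ringI ag) (auto simp: A.l_distr A.r_distr simp del: hom(1,2))
  moreover have "module R B"
    by (rule moduleI[OF A.R.is_cring ag])
      (auto simp: A.smult_l_distr A.smult_r_distr A.smult_assoc1 simp del: hom(1,2))
  moreover have "r_algebra_axioms R B"
    by unfold_locales (auto simp: A.smult_mult_left A.smult_mult_right simp del: hom(1,2))
  ultimately show ?thesis
    by (intro r_algebra.intro)
qed

context r_algebra
begin

text \<open>Closure under negation comes from the scalar -1.\<close>

lemma submoduleI':
  assumes "B \<subseteq> carrier A" "\<zero>\<^bsub>A\<^esub> \<in> B"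
    and "\<And>x y. x \<in> B \<Longrightarrow> y \<in> B \<Longrightarrow> x \<oplus>\<^bsub>A\<^esub> y \<in> B"
    and "\<And>r x. r \<in> carrier R \<Longrightarrow> x \<in> B \<Longrightarrow> r \<odot>\<^bsub>A\<^esub> x \<in> B"
  shows "submodule B R A"
proof (rule submoduleI)
  fix x assume "x \<in> B"
  then show "\<ominus>\<^bsub>A\<^esub> x \<in> B"
    using assms(1) assms(4)[of "\<ominus>\<^bsub>R\<^esub> \<one>\<^bsub>R\<^esub>" x] smult_l_minus[of "\<one>\<^bsub>R\<^esub>" x] by auto
qed (use assms in auto)

lemma subalgebraI:
  assumes "B \<subseteq> carrier A" "\<one>\<^bsub>A\<^esub> \<in> B"
    and "\<And>x y. x \<in> B \<Longrightarrow> y \<in> B \<Longrightarrow> x \<oplus>\<^bsub>A\<^esub> y \<in> B"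
    and "\<And>x y. x \<in> B \<Longrightarrow> y \<in> B \<Longrightarrow> x \<otimes>\<^bsub>A\<^esub> y \<in> B"
    and "\<And>r x. r \<in> carrier R \<Longrightarrow> x \<in> B \<Longrightarrow> r \<odot>\<^bsub>A\<^esub> x \<in> B"
  shows "subring B A" "submodule B R A"
proof -
  have "\<zero>\<^bsub>A\<^esub> \<in> B"
    using assms(5)[of "\<zero>\<^bsub>R\<^esub>" "\<one>\<^bsub>A\<^esub>"] assms(2) by simp
  then show sub: "submodule B R A"
    using assms by (intro submoduleI') auto
  show "subring B A"
    using assms submoduleE(3)[OF sub] by (intro subringI) auto
qed

lemma
  assumes "S \<subseteq> carrier A"
  shows generated_subring: "subring (generated_subalgebra R A S) A"
    and generated_submodule: "submodule (generated_subalgebra R A S) R A"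
proof -
  define F where "F = {B. subring B A \<and> submodule B R A \<and> S \<subseteq> B}"
  have gen: "generated_subalgebra R A S = \<Inter>F"
    by (simp add: generated_subalgebra_def F_def)
  \<comment> \<open>The family must be nonempty for its intersection to be a subring.\<close>
  have c: "carrier A \<in> F"
    using assms carrier_is_subring carrier_is_submodule by (simp add: F_def)
  show 1: "subring (generated_subalgebra R A S) A"
    unfolding gen using c by (intro subring_Inter) (auto simp: F_def)
  have "r \<odot>\<^bsub>A\<^esub> x \<in> \<Inter>F" if "r \<in> carrier R" "x \<in> \<Inter>F" for r x
    using that submoduleE(4) by (fastforce simp: F_def)
  then show "submodule (generated_subalgebra R A S) R A"
    using subringE[OF 1] unfolding gen by (intro submoduleI) auto
qed

lemma generated_subalgebra_incl: "s \<in> S \<Longrightarrow> s \<in> generated_subalgebra R A S"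
  by (auto simp: generated_subalgebra_def)

text \<open>The elements satisfying \<open>Q\<close> form a subalgebra that contains
  \<open>S\<close>. The cases also provide membership in the generated subalgebra, since the algebra
  laws apply only inside the carrier.\<close>

lemma generated_subalgebra_induct [consumes 2, case_names gen one add mult smult]:
  assumes x: "x \<in> generated_subalgebra R A S" and S: "S \<subseteq> carrier A"
    and "\<And>s. s \<in> S \<Longrightarrow> Q s" and "Q \<one>\<^bsub>A\<^esub>"
    and "\<And>x y. \<lbrakk>x \<in> generated_subalgebra R A S; y \<in> generated_subalgebra R A S; Q x; Q y\<rbrakk> \<Longrightarrow> Q (x \<oplus>\<^bsub>A\<^esub> y)"
    and "\<And>x y. \<lbrakk>x \<in> generated_subalgebra R A S; y \<in> generated_subalgebra R A S; Q x; Q y\<rbrakk> \<Longrightarrow> Q (x \<otimes>\<^bsub>A\<^esub> y)"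
    and "\<And>r x. \<lbrakk>r \<in> carrier R; x \<in> generated_subalgebra R A S; Q x\<rbrakk> \<Longrightarrow> Q (r \<odot>\<^bsub>A\<^esub> x)"
  shows "Q x"
proof -
  define B where "B = {x \<in> generated_subalgebra R A S. Q x}"
  note gr = subringE[OF generated_subring[OF S]]
  note gm = submoduleE(4)[OF generated_submodule[OF S]]
  have "subring B A" "submodule B R A"
    using assms gr gm by (auto simp: B_def intro!: subalgebraI)
  moreover have "S \<subseteq> B"
    using assms generated_subalgebra_incl by (auto simp: B_def)
  ultimately have "x \<in> B"
    using x unfolding generated_subalgebra_def by blast
  then show ?thesis
    by (simp add: B_def)
qed

end

text \<open>Gives the uniqueness of the map in the theorem, and lets bijectivity of one explicit
  homomorphism pass to every homomorphism with the same values on generators.\<close>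

lemma unital_alg_hom_unique:
  assumes "r_algebra R A" "r_algebra R B"
    and \<Phi>: "\<Phi> \<in> unital_alg_hom R A B" "\<Phi>' \<in> unital_alg_hom R A B"
    and S: "S \<subseteq> carrier A" "\<And>s. s \<in> S \<Longrightarrow> \<Phi> s = \<Phi>' s"
    and x: "x \<in> generated_subalgebra R A S"
  shows "\<Phi> x = \<Phi>' x"
proof -
  interpret A: r_algebra R A by fact
  have c: "y \<in> carrier A" if "y \<in> generated_subalgebra R A S" for y
    using that subringE(1)[OF A.generated_subring[OF S(1)]] by auto
  show ?thesis
    using x S(1)
    by (induction rule: A.generated_subalgebra_induct)
      (use \<Phi> S c in \<open>auto simp: unital_alg_hom_def alg_hom_def\<close>)
qed

section \<open>Partial representations\<close>

text \<open>Keeping \<open>P\<close> abstract isolates what follows from the three identities of the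
  generators from the representation of \<open>R_par\<close> by cosets.\<close>

locale partial_representation = P: r_algebra R P + G: group G
  for R :: "('r, 'p) ring_scheme" and P :: "('r, 'a, 's) module_scheme" (structure)
    and G :: "('g, 'q) monoid_scheme" +
  fixes p :: "'g \<Rightarrow> 'a"
  assumes p_closed [simp]: "g \<in> carrier G \<Longrightarrow> p g \<in> carrier P"
    and p_one: "p \<one>\<^bsub>G\<^esub> = \<one>"
    and p_left: "\<lbrakk>g \<in> carrier G; h \<in> carrier G\<rbrakk> \<Longrightarrow>
      p (inv\<^bsub>G\<^esub> g) \<otimes> p g \<otimes> p h = p (inv\<^bsub>G\<^esub> g) \<otimes> p (g \<otimes>\<^bsub>G\<^esub> h)"
    and p_right: "\<lbrakk>g \<in> carrier G; h \<in> carrier G\<rbrakk> \<Longrightarrow>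
      p g \<otimes> p h \<otimes> p (inv\<^bsub>G\<^esub> h) = p (g \<otimes>\<^bsub>G\<^esub> h) \<otimes> p (inv\<^bsub>G\<^esub> h)"
begin

definition eps :: "'g \<Rightarrow> 'a"
  where "eps g = p g \<otimes> p (inv\<^bsub>G\<^esub> g)"

definition E :: "'a set"
  where "E = generated_subalgebra R P (eps ` carrier G)"

definition D :: "'g \<Rightarrow> 'a set"
  where "D g = {a \<otimes> eps g | a. a \<in> E}"

definition conjugate :: "'g \<Rightarrow> 'a \<Rightarrow> 'a"
  where "conjugate g x = p g \<otimes> x \<otimes> p (inv\<^bsub>G\<^esub> g)"

lemma eps_closed [simp]: "g \<in> carrier G \<Longrightarrow> eps g \<in> carrier P"
  by (simp add: eps_def)

lemma eps_one: "eps \<one>\<^bsub>G\<^esub> = \<one>"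
  by (simp add: eps_def p_one)

text \<open>The left relation for g^-1 and g, whose product is e. It makes [g^-1] a generalised
  inverse of [g], which is why the eps_g are idempotent.\<close>

lemma p_p_inv_p: "g \<in> carrier G \<Longrightarrow> p g \<otimes> (p (inv\<^bsub>G\<^esub> g) \<otimes> p g) = p g"
  using p_left[of "inv\<^bsub>G\<^esub> g" g] by (simp add: p_one P.m_assoc)

lemma eps_p: "g \<in> carrier G \<Longrightarrow> eps g \<otimes> p g = p g"
  by (simp add: eps_def P.m_assoc p_p_inv_p)

lemma p_eps_inv: "g \<in> carrier G \<Longrightarrow> p g \<otimes> eps (inv\<^bsub>G\<^esub> g) = p g"
  by (simp add: eps_def p_p_inv_p)

text \<open>The rule that moves idempotents past generators. The right relation merges g and h into
  k = gh; inserting [k^-1][k] after [k] makes room for the left relation, which splits h off again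
  and leaves [g].\<close>

lemma p_eps:
  assumes [simp]: "g \<in> carrier G" "h \<in> carrier G"
  shows "p g \<otimes> eps h = eps (g \<otimes>\<^bsub>G\<^esub> h) \<otimes> p g"
proof -
  let ?k = "g \<otimes>\<^bsub>G\<^esub> h"
  have "p g \<otimes> eps h = p ?k \<otimes> p (inv\<^bsub>G\<^esub> h)"
    using p_right[of g h] by (simp add: eps_def P.m_assoc)
  also have "\<dots> = p ?k \<otimes> (p (inv\<^bsub>G\<^esub> ?k) \<otimes> p ?k) \<otimes> p (inv\<^bsub>G\<^esub> h)"
    by (simp add: p_p_inv_p)
  also have "\<dots> = p ?k \<otimes> (p (inv\<^bsub>G\<^esub> ?k) \<otimes> p ?k \<otimes> p (inv\<^bsub>G\<^esub> h))"
    by (simp add: P.m_assoc)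
  also have "\<dots> = p ?k \<otimes> (p (inv\<^bsub>G\<^esub> ?k) \<otimes> p (?k \<otimes>\<^bsub>G\<^esub> inv\<^bsub>G\<^esub> h))"
    by (subst p_left) simp_all
  also have "?k \<otimes>\<^bsub>G\<^esub> inv\<^bsub>G\<^esub> h = g"
    by (simp add: G.m_assoc)
  finally show ?thesis
    by (simp add: eps_def P.m_assoc)
qed

lemma eps_idem: "g \<in> carrier G \<Longrightarrow> eps g \<otimes> eps g = eps g"
  by (metis G.inv_closed P.m_assoc eps_closed eps_def eps_p p_closed)

text \<open>Moving eps_h leftwards past [g^-1] turns it into eps_(g^-1 h), and past [g] it becomes
  eps_h again.\<close>

lemma eps_commute:
  assumes [simp]: "g \<in> carrier G" "h \<in> carrier G"
  shows "eps g \<otimes> eps h = eps h \<otimes> eps g"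
proof -
  have "eps g \<otimes> eps h = p g \<otimes> (p (inv\<^bsub>G\<^esub> g) \<otimes> eps h)"
    by (simp add: eps_def P.m_assoc)
  also have "\<dots> = p g \<otimes> eps (inv\<^bsub>G\<^esub> g \<otimes>\<^bsub>G\<^esub> h) \<otimes> p (inv\<^bsub>G\<^esub> g)"
    by (simp add: p_eps[of "inv\<^bsub>G\<^esub> g" h] P.m_assoc)
  also have "\<dots> = eps (g \<otimes>\<^bsub>G\<^esub> (inv\<^bsub>G\<^esub> g \<otimes>\<^bsub>G\<^esub> h)) \<otimes> p g \<otimes> p (inv\<^bsub>G\<^esub> g)"
    by (subst p_eps) simp_all
  also have "\<dots> = eps h \<otimes> eps g"
    by (simp add: G.m_assoc[symmetric] eps_def P.m_assoc)
  finally show ?thesis .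
qed

lemma eps_image_subset: "eps ` carrier G \<subseteq> carrier P"
  by auto

lemmas E_subring = P.generated_subring[OF eps_image_subset, folded E_def]
lemmas E_submodule = P.generated_submodule[OF eps_image_subset, folded E_def]
lemmas E_induct [consumes 1, case_names gen one add mult smult] =
  P.generated_subalgebra_induct[OF _ eps_image_subset, folded E_def]

lemma E_carrier [simp]: "x \<in> E \<Longrightarrow> x \<in> carrier P"
  using subringE(1)[OF E_subring] by auto

lemma E_closed [simp]:
  "\<zero> \<in> E" "\<one> \<in> E" "x \<in> E \<Longrightarrow> y \<in> E \<Longrightarrow> x \<oplus> y \<in> E" "x \<in> E \<Longrightarrow> y \<in> E \<Longrightarrow> x \<otimes> y \<in> E"
  "r \<in> carrier R \<Longrightarrow> x \<in> E \<Longrightarrow> r \<odot> x \<in> E"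
  using subringE[OF E_subring] P.submoduleE(4)[OF E_submodule] by auto

lemma eps_E [simp]: "g \<in> carrier G \<Longrightarrow> eps g \<in> E"
  by (simp add: E_def P.generated_subalgebra_incl)

text \<open>Commutativity of \<open>E\<close> takes one induction for each factor. Here
  \<open>y\<close> is any element of the algebra, so the lemma serves both times.\<close>

lemma E_commute_if_gen:
  assumes "x \<in> E" "y \<in> carrier P" "\<And>g. g \<in> carrier G \<Longrightarrow> eps g \<otimes> y = y \<otimes> eps g"
  shows "x \<otimes> y = y \<otimes> x"
  using assms(1)
proof (induction rule: E_induct)
  case (mult u v)
  then show ?case
    using assms(2) by (metis E_carrier P.m_assoc)
next
  case (smult r u)
  then show ?case
    using assms(2) by (simp add: P.smult_mult_left P.smult_mult_right)
qed (use assms in \<open>auto simp: P.l_distr P.r_distr\<close>)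

lemma E_commute:
  assumes "x \<in> E" "y \<in> E"
  shows "x \<otimes> y = y \<otimes> x"
proof (rule E_commute_if_gen[OF assms(1)])
  fix g assume "g \<in> carrier G"
  then show "eps g \<otimes> y = y \<otimes> eps g"
    using E_commute_if_gen[OF assms(2), of "eps g"] eps_commute by auto
qed (use assms in auto)

lemma E_r_algebra: "r_algebra R (P\<lparr>carrier := E\<rparr>)"
  by (rule r_algebra_pullback[OF P.r_algebra_axioms, where f = id]) auto

text \<open>By idempotence, membership in the ideal means being fixed by eps_g; this replaces the
  existential in \<open>D\<close> from here on.\<close>

lemma D_iff: "g \<in> carrier G \<Longrightarrow> x \<in> D g \<longleftrightarrow> x \<in> E \<and> x \<otimes> eps g = x"
  unfolding D_def by (auto simp: P.m_assoc eps_idem) (metis)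

lemma D_E: "g \<in> carrier G \<Longrightarrow> x \<in> D g \<Longrightarrow> x \<in> E"
  by (simp add: D_iff)

lemma D_carrier: "g \<in> carrier G \<Longrightarrow> x \<in> D g \<Longrightarrow> x \<in> carrier P"
  by (simp add: D_iff)

lemma D_closed:
  assumes "g \<in> carrier G"
  shows "\<zero> \<in> D g" "x \<in> D g \<Longrightarrow> y \<in> D g \<Longrightarrow> x \<oplus> y \<in> D g"
    "x \<in> D g \<Longrightarrow> y \<in> E \<Longrightarrow> x \<otimes> y \<in> D g" "x \<in> D g \<Longrightarrow> y \<in> E \<Longrightarrow> y \<otimes> x \<in> D g"
    "r \<in> carrier R \<Longrightarrow> x \<in> D g \<Longrightarrow> r \<odot> x \<in> D g" "eps g \<in> D g"
proof -
  show y: "x \<in> D g \<Longrightarrow> y \<in> E \<Longrightarrow> y \<otimes> x \<in> D g"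
    using assms by (simp add: D_iff P.m_assoc)
  then show "x \<in> D g \<Longrightarrow> y \<in> E \<Longrightarrow> x \<otimes> y \<in> D g"
    using assms by (metis E_commute D_E)
qed (use assms in \<open>auto simp: D_iff P.l_distr P.smult_mult_left eps_idem\<close>)

lemma D_one: "D \<one>\<^bsub>G\<^esub> = E"
  by (auto simp: D_iff eps_one)

lemma D_ideal:
  assumes "g \<in> carrier G"
  shows "ideal (D g) (P\<lparr>carrier := E\<rparr>)"
proof -
  interpret E: r_algebra R "P\<lparr>carrier := E\<rparr>" by (rule E_r_algebra)
  have "submodule (D g) R (P\<lparr>carrier := E\<rparr>)"
    using assms by (intro E.submoduleI') (auto simp: D_closed D_E)
  then show ?thesis
    using assms by (intro idealI E.ring_axioms) (auto simp: submodule_def D_closed)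
qed

text \<open>Extends \<open>p_eps\<close> to all of \<open>E\<close>. An existential is enough:
  multiplication by [g^-1] on the right then exhibits the conjugate as a multiple of eps_g by an
  element of \<open>E\<close>.\<close>

lemma p_E:
  assumes "g \<in> carrier G" "x \<in> E"
  shows "\<exists>y\<in>E. p g \<otimes> x = y \<otimes> p g"
  using assms(2)
proof (induction rule: E_induct)
  case (gen s)
  then obtain h where "h \<in> carrier G" "s = eps h" by auto
  then show ?case
    using assms(1) p_eps by (intro bexI[of _ "eps (g \<otimes>\<^bsub>G\<^esub> h)"]) auto
next
  case one
  then show ?case
    using assms(1) by (intro bexI[of _ \<one>]) auto
next
  case (add x y)
  then obtain x' y' where "x' \<in> E" "y' \<in> E" "p g \<otimes> x = x' \<otimes> p g" "p g \<otimes> y = y' \<otimes> p g"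
    by auto
  then show ?case
    using assms(1) add by (intro bexI[of _ "x' \<oplus> y'"]) (auto simp: P.l_distr P.r_distr)
next
  case (mult x y)
  then obtain x' y' where *: "x' \<in> E" "y' \<in> E" "p g \<otimes> x = x' \<otimes> p g" "p g \<otimes> y = y' \<otimes> p g"
    by auto
  have "p g \<otimes> (x \<otimes> y) = (p g \<otimes> x) \<otimes> y"
    using assms(1) mult by (simp add: P.m_assoc)
  also have "\<dots> = x' \<otimes> (p g \<otimes> y)"
    using assms(1) mult * by (simp add: P.m_assoc)
  also have "\<dots> = (x' \<otimes> y') \<otimes> p g"
    using assms(1) * by (simp add: P.m_assoc)
  finally show ?case
    using * by (intro bexI[of _ "x' \<otimes> y'"]) auto
next
  case (smult r x)
  then obtain x' where "x' \<in> E" "p g \<otimes> x = x' \<otimes> p g"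
    by auto
  then show ?case
    using assms(1) smult
    by (intro bexI[of _ "r \<odot> x'"]) (auto simp: P.smult_mult_left P.smult_mult_right)
qed

lemma conjugate_closed:
  assumes "g \<in> carrier G" "x \<in> E"
  shows "conjugate g x \<in> D g"
proof -
  obtain y where "y \<in> E" "p g \<otimes> x = y \<otimes> p g"
    using p_E[OF assms] by auto
  then have "conjugate g x = y \<otimes> eps g"
    using assms(1) by (simp add: conjugate_def eps_def P.m_assoc)
  then show ?thesis
    using \<open>y \<in> E\<close> by (auto simp: D_def)
qed

lemma conjugate_add:
  assumes "g \<in> carrier G" "x \<in> E" "y \<in> E"
  shows "conjugate g (x \<oplus> y) = conjugate g x \<oplus> conjugate g y"
  using assms by (simp add: conjugate_def P.l_distr P.r_distr)

lemma conjugate_smult: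
  assumes "g \<in> carrier G" "r \<in> carrier R" "x \<in> E"
  shows "conjugate g (r \<odot> x) = r \<odot> conjugate g x"
  using assms by (simp add: conjugate_def P.smult_mult_left P.smult_mult_right)

text \<open>The factor eps_(g^-1) that appears between \<open>x\<close> and \<open>y\<close>
  commutes with \<open>x\<close> and is absorbed by [g].\<close>

lemma conjugate_mult:
  assumes "g \<in> carrier G" "x \<in> E" "y \<in> E"
  shows "conjugate g (x \<otimes> y) = conjugate g x \<otimes> conjugate g y"
proof -
  have "conjugate g x \<otimes> conjugate g y = p g \<otimes> (x \<otimes> eps (inv\<^bsub>G\<^esub> g)) \<otimes> y \<otimes> p (inv\<^bsub>G\<^esub> g)"
    using assms by (simp add: conjugate_def eps_def P.m_assoc)
  also have "x \<otimes> eps (inv\<^bsub>G\<^esub> g) = eps (inv\<^bsub>G\<^esub> g) \<otimes> x"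
    using assms by (simp add: E_commute)
  also have "p g \<otimes> (eps (inv\<^bsub>G\<^esub> g) \<otimes> x) = p g \<otimes> x"
    using assms p_eps_inv by (simp add: P.m_assoc[symmetric])
  finally show ?thesis
    using assms by (simp add: conjugate_def P.m_assoc)
qed

lemma conjugate_eps:
  assumes "g \<in> carrier G" "h \<in> carrier G"
  shows "conjugate g (eps h) = eps (g \<otimes>\<^bsub>G\<^esub> h) \<otimes> eps g"
  using assms by (simp add: conjugate_def p_eps P.m_assoc) (simp add: eps_def)

lemma conjugate_eps_inv:
  assumes "g \<in> carrier G"
  shows "conjugate g (eps (inv\<^bsub>G\<^esub> g)) = eps g"
  using assms by (simp add: conjugate_def p_eps_inv) (simp add: eps_def)

text \<open>The relations merge [g][h] into [gh] only next to an eps_(h^-1), and likewise for the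
  inverses on the right. Since \<open>x\<close> is fixed by eps_(h^-1), it can supply one on each
  side.\<close>

lemma conjugate_conjugate:
  assumes "g \<in> carrier G" "h \<in> carrier G" "x \<in> D (inv\<^bsub>G\<^esub> h)"
  shows "conjugate g (conjugate h x) = conjugate (g \<otimes>\<^bsub>G\<^esub> h) x"
proof -
  have x [simp]: "x \<in> E" "eps (inv\<^bsub>G\<^esub> h) \<otimes> x = x" "x \<otimes> eps (inv\<^bsub>G\<^esub> h) = x"
    using assms E_commute[of x "eps (inv\<^bsub>G\<^esub> h)"] by (auto simp: D_iff)
  note [simp] = assms(1,2)
  have l: "p g \<otimes> (p h \<otimes> eps (inv\<^bsub>G\<^esub> h)) = p (g \<otimes>\<^bsub>G\<^esub> h) \<otimes> eps (inv\<^bsub>G\<^esub> h)"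
    using p_right[of g h] by (simp add: eps_def P.m_assoc[symmetric])
  have r: "eps (inv\<^bsub>G\<^esub> h) \<otimes> p (inv\<^bsub>G\<^esub> h) \<otimes> p (inv\<^bsub>G\<^esub> g)
      = eps (inv\<^bsub>G\<^esub> h) \<otimes> p (inv\<^bsub>G\<^esub> h \<otimes>\<^bsub>G\<^esub> inv\<^bsub>G\<^esub> g)"
    using p_left[of h "inv\<^bsub>G\<^esub> h \<otimes>\<^bsub>G\<^esub> inv\<^bsub>G\<^esub> g"] eps_p[of "inv\<^bsub>G\<^esub> h"]
    by (simp add: eps_def G.m_assoc[symmetric])
  have "conjugate g (conjugate h x) = p g \<otimes> p h \<otimes> (eps (inv\<^bsub>G\<^esub> h) \<otimes> x \<otimes> eps (inv\<^bsub>G\<^esub> h)) \<otimes> p (inv\<^bsub>G\<^esub> h) \<otimes> p (inv\<^bsub>G\<^esub> g)"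
    by (simp add: conjugate_def P.m_assoc)
  \<comment> \<open>The inserted idempotents must stay visible until both relations have been
    applied, so the rules that absorb them into \<open>x\<close> are switched off.\<close>
  also have "\<dots> = (p g \<otimes> (p h \<otimes> eps (inv\<^bsub>G\<^esub> h))) \<otimes> x \<otimes> (eps (inv\<^bsub>G\<^esub> h) \<otimes> p (inv\<^bsub>G\<^esub> h) \<otimes> p (inv\<^bsub>G\<^esub> g))"
    by (simp add: P.m_assoc del: x(2,3))
  also have "\<dots> = p (g \<otimes>\<^bsub>G\<^esub> h) \<otimes> (eps (inv\<^bsub>G\<^esub> h) \<otimes> x \<otimes> eps (inv\<^bsub>G\<^esub> h)) \<otimes> p (inv\<^bsub>G\<^esub> h \<otimes>\<^bsub>G\<^esub> inv\<^bsub>G\<^esub> g)"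
    unfolding l r by (simp add: P.m_assoc del: x(2,3))
  also have "\<dots> = conjugate (g \<otimes>\<^bsub>G\<^esub> h) x"
    by (simp add: conjugate_def G.inv_mult_group)
  finally show ?thesis .
qed


lemma conjugate_one: "x \<in> E \<Longrightarrow> conjugate \<one>\<^bsub>G\<^esub> x = x"
  by (simp add: conjugate_def p_one)

lemma conjugate_inv_conjugate:
  assumes "g \<in> carrier G" "x \<in> D (inv\<^bsub>G\<^esub> g)"
  shows "conjugate (inv\<^bsub>G\<^esub> g) (conjugate g x) = x"
  using assms by (simp add: conjugate_conjugate conjugate_one D_E[of "inv\<^bsub>G\<^esub> g"])

lemma conjugate_bij:
  assumes "g \<in> carrier G"
  shows "bij_betw (conjugate g) (D (inv\<^bsub>G\<^esub> g)) (D g)"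
proof (rule bij_betw_byWitness[where f' = "conjugate (inv\<^bsub>G\<^esub> g)"])
  show "\<forall>x\<in>D g. conjugate g (conjugate (inv\<^bsub>G\<^esub> g) x) = x"
    using assms conjugate_inv_conjugate[of "inv\<^bsub>G\<^esub> g"] by simp
  show "conjugate (inv\<^bsub>G\<^esub> g) ` D g \<subseteq> D (inv\<^bsub>G\<^esub> g)"
    using assms conjugate_closed[of "inv\<^bsub>G\<^esub> g"] D_E by auto
qed (use assms conjugate_inv_conjugate conjugate_closed D_E[of "inv\<^bsub>G\<^esub> g"] in auto)

abbreviation EA :: "('r, 'a, 's) module_scheme"
  where "EA \<equiv> P\<lparr>carrier := E\<rparr>"

definition theta_maps :: "'g \<Rightarrow> ('a \<Rightarrow> 'a) set"
  where "theta_maps g =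
    {\<phi> \<in> alg_hom R (EA\<lparr>carrier := D (inv\<^bsub>G\<^esub> g)\<rparr>) (EA\<lparr>carrier := D g\<rparr>).
      \<forall>h\<in>carrier G. \<phi> (eps h \<otimes>\<^bsub>EA\<^esub> eps (inv\<^bsub>G\<^esub> g)) = eps (g \<otimes>\<^bsub>G\<^esub> h) \<otimes>\<^bsub>EA\<^esub> eps g}"

text \<open>Multiplication by eps_(g^-1) maps \<open>E\<close> onto D_(g^-1). Hence the induction
  runs over \<open>E\<close>, and its claim concerns \<open>y\<close> times that idempotent.\<close>

lemma theta_maps_conjugate:
  assumes g: "g \<in> carrier G" and \<phi>: "\<phi> \<in> theta_maps g" and x: "x \<in> D (inv\<^bsub>G\<^esub> g)"
  shows "\<phi> x = conjugate g x"
proof -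
  let ?e = "eps (inv\<^bsub>G\<^esub> g)"
  note [simp] = g
  have e: "?e \<otimes> ?e = ?e" "y \<otimes> ?e \<in> D (inv\<^bsub>G\<^esub> g)" if "y \<in> E" for y
    using that by (auto simp: eps_idem D_def)
  have hom: "\<phi> (y \<oplus> z) = \<phi> y \<oplus> \<phi> z" "\<phi> (y \<otimes> z) = \<phi> y \<otimes> \<phi> z"
    if "y \<in> D (inv\<^bsub>G\<^esub> g)" "z \<in> D (inv\<^bsub>G\<^esub> g)" for y z
    using \<phi> that by (auto simp: theta_maps_def alg_hom_def)
  have hom_smult: "\<phi> (r \<odot> y) = r \<odot> \<phi> y" if "r \<in> carrier R" "y \<in> D (inv\<^bsub>G\<^esub> g)" for r y
    using \<phi> that by (auto simp: theta_maps_def alg_hom_def)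
  have \<phi>_eps: "\<phi> (eps h \<otimes> ?e) = eps (g \<otimes>\<^bsub>G\<^esub> h) \<otimes> eps g" if "h \<in> carrier G" for h
    using \<phi> that by (auto simp: theta_maps_def)
  have conjugate_eps_e: "conjugate g (eps h \<otimes> ?e) = eps (g \<otimes>\<^bsub>G\<^esub> h) \<otimes> eps g" if "h \<in> carrier G" for h
    using that by (simp add: conjugate_mult conjugate_eps_inv conjugate_eps P.m_assoc eps_idem eps_one)
  have gen: "\<phi> (y \<otimes> ?e) = conjugate g (y \<otimes> ?e)" if "y \<in> E" for y
    using that
  proof (induction rule: E_induct)
    case (gen s)
    then show ?case
      by (auto simp: \<phi>_eps conjugate_eps_e)
  next
    \<comment> \<open>The unit is the case h = e of the prescribed values.\<close>
    case one
    then show ?case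
      using \<phi>_eps[of "\<one>\<^bsub>G\<^esub>"] conjugate_eps_e[of "\<one>\<^bsub>G\<^esub>"] by (simp add: eps_one)
  next
    case (add y z)
    then show ?case
      using e by (simp add: P.l_distr hom conjugate_add)
  next
    case (mult y z)
    \<comment> \<open>The idempotent is doubled so that each factor gets its own copy:
      \<open>\<phi>\<close> is multiplicative only inside D_(g^-1).\<close>
    have "y \<otimes> z \<otimes> ?e = y \<otimes> (z \<otimes> ?e) \<otimes> ?e"
      using mult by (simp add: P.m_assoc eps_idem)
    also have "\<dots> = (y \<otimes> ?e) \<otimes> (z \<otimes> ?e)"
      using mult E_commute[of "z \<otimes> ?e" ?e] by (simp add: P.m_assoc)
    finally show ?case
      using mult e by (simp add: hom conjugate_mult)
  next
    case (smult r y)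
    then show ?case
      using e by (simp add: P.smult_mult_left hom_smult conjugate_smult)
  qed
  show ?thesis
    using gen[of x] x by (simp add: D_iff)
qed

text \<open>Agreement on D_(g^-1) is all that is asked, so this applies both to the restricted map
  that witnesses existence and to an arbitrary family theta.\<close>

lemma theta_maps_if_conjugate:
  assumes g: "g \<in> carrier G" and \<phi>: "\<And>x. x \<in> D (inv\<^bsub>G\<^esub> g) \<Longrightarrow> \<phi> x = conjugate g x"
  shows "\<phi> \<in> theta_maps g"
proof -
  have i: "inv\<^bsub>G\<^esub> g \<in> carrier G"
    using g by simp
  have "\<phi> (eps h \<otimes> eps (inv\<^bsub>G\<^esub> g)) = eps (g \<otimes>\<^bsub>G\<^esub> h) \<otimes> eps g" if "h \<in> carrier G" for h
  proof -
    have "eps h \<otimes> eps (inv\<^bsub>G\<^esub> g) \<in> D (inv\<^bsub>G\<^esub> g)"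
      using that by (auto simp: D_def)
    then show ?thesis
      using that g by (simp add: \<phi> conjugate_mult conjugate_eps_inv conjugate_eps P.m_assoc eps_idem eps_one)
  qed
  moreover have "\<phi> \<in> alg_hom R (EA\<lparr>carrier := D (inv\<^bsub>G\<^esub> g)\<rparr>) (EA\<lparr>carrier := D g\<rparr>)"
    using g D_E[OF i]
    by (auto simp: alg_hom_def \<phi> conjugate_closed conjugate_add conjugate_mult conjugate_smult D_closed[OF i])
  ultimately show ?thesis
    by (simp add: theta_maps_def)
qed

text \<open>The values outside D_(g^-1) are unconstrained, so uniqueness is expressed among
  extensional maps.\<close>

lemma theta_maps_ex1:
  assumes "g \<in> carrier G"
  shows "\<exists>!\<phi>. \<phi> \<in> theta_maps g \<inter> extensional (D (inv\<^bsub>G\<^esub> g))"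
proof (rule ex1I[of _ "restrict (conjugate g) (D (inv\<^bsub>G\<^esub> g))"])
  show "restrict (conjugate g) (D (inv\<^bsub>G\<^esub> g)) \<in> theta_maps g \<inter> extensional (D (inv\<^bsub>G\<^esub> g))"
    using assms by (auto intro!: theta_maps_if_conjugate)
next
  fix \<phi> assume "\<phi> \<in> theta_maps g \<inter> extensional (D (inv\<^bsub>G\<^esub> g))"
  then show "\<phi> = restrict (conjugate g) (D (inv\<^bsub>G\<^esub> g))"
    using theta_maps_conjugate[OF assms] by (auto intro: extensionalityI[where A = "D (inv\<^bsub>G\<^esub> g)"])
qed

text \<open>As x = x eps_h, the conjugate acquires the factor eps_(gh).\<close>

lemma conjugate_D_Int:
  assumes "g \<in> carrier G" "h \<in> carrier G" "x \<in> D h"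
  shows "conjugate g x \<in> D (g \<otimes>\<^bsub>G\<^esub> h)"
proof -
  have x: "x \<in> E" "x \<otimes> eps h = x"
    using assms by (auto simp: D_iff)
  have "conjugate g x = conjugate g (x \<otimes> eps h)"
    by (simp add: x)
  also have "\<dots> = conjugate g x \<otimes> (eps (g \<otimes>\<^bsub>G\<^esub> h) \<otimes> eps g)"
    using assms x(1) by (simp add: conjugate_mult conjugate_eps)
  also have "\<dots> = conjugate g x \<otimes> eps g \<otimes> eps (g \<otimes>\<^bsub>G\<^esub> h)"
    using assms x(1) conjugate_closed[of g x] D_E by (simp add: P.m_assoc eps_commute)
  also have "\<dots> \<in> D (g \<otimes>\<^bsub>G\<^esub> h)"
    using assms x(1) conjugate_closed[of g x] D_E[of g] unfolding D_def[of "g \<otimes>\<^bsub>G\<^esub> h"] by auto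
  finally show ?thesis .
qed

lemma partial_action_conjugate:
  assumes \<theta>: "\<And>g x. g \<in> carrier G \<Longrightarrow> x \<in> D (inv\<^bsub>G\<^esub> g) \<Longrightarrow> \<theta> g x = conjugate g x"
  shows "partial_action R G EA D \<theta>"
  unfolding partial_action_def
proof (intro conjI ballI)
  show "r_algebra R EA"
    by (rule E_r_algebra)
next
  fix g assume g: "g \<in> carrier G"
  show "ideal (D g) EA"
    using g by (rule D_ideal)
  show "\<theta> g \<in> alg_hom R (EA\<lparr>carrier := D (inv\<^bsub>G\<^esub> g)\<rparr>) (EA\<lparr>carrier := D g\<rparr>)"
    using theta_maps_if_conjugate[OF g \<theta>[OF g]] by (simp add: theta_maps_def)
  show "bij_betw (\<theta> g) (D (inv\<^bsub>G\<^esub> g)) (D g)"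
    using conjugate_bij[OF g] bij_betw_cong[of "D (inv\<^bsub>G\<^esub> g)" "\<theta> g" "conjugate g"] \<theta>[OF g] by simp
  fix h assume h: "h \<in> carrier G"
  show "\<theta> g ` (D (inv\<^bsub>G\<^esub> g) \<inter> D h) \<subseteq> D (g \<otimes>\<^bsub>G\<^esub> h)"
    using g h \<theta>[OF g] conjugate_D_Int by auto
  fix x assume x: "x \<in> D (inv\<^bsub>G\<^esub> h) \<inter> D (inv\<^bsub>G\<^esub> (g \<otimes>\<^bsub>G\<^esub> h))"
  \<comment> \<open>The outer map is known to be conjugation only on D_(g^-1), so its argument must
    be placed there; the membership of \<open>x\<close> in D_((gh)^-1) provides this.\<close>
  have "conjugate h x \<in> D (h \<otimes>\<^bsub>G\<^esub> inv\<^bsub>G\<^esub> (g \<otimes>\<^bsub>G\<^esub> h))"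
    using g h x by (intro conjugate_D_Int) auto
  also have "h \<otimes>\<^bsub>G\<^esub> inv\<^bsub>G\<^esub> (g \<otimes>\<^bsub>G\<^esub> h) = inv\<^bsub>G\<^esub> g"
    using g h by (simp add: G.inv_mult_group G.m_assoc[symmetric])
  finally show "\<theta> g (\<theta> h x) = \<theta> (g \<otimes>\<^bsub>G\<^esub> h) x"
    using g h x by (simp add: \<theta> conjugate_conjugate)
qed (use \<theta>[of "\<one>\<^bsub>G\<^esub>"] in \<open>simp_all add: D_one conjugate_one\<close>)

end

section \<open>Graded partial representations\<close>

text \<open>The assumption \<open>generating\<close> gives surjectivity of \<open>\<Psi>\<close>,
  and the family \<open>H\<close> gives injectivity, where \<open>H_independent\<close> allows a
  vanishing sum to be treated degree by degree.\<close>

locale graded_partial_representation = partial_representation R P G p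
  for R :: "('r, 'p) ring_scheme" and P :: "('r, 'a, 's) module_scheme" (structure)
    and G :: "('g, 'q) monoid_scheme" and p :: "'g \<Rightarrow> 'a" +
  fixes H :: "'g \<Rightarrow> 'a set"
  assumes generating: "generated_subalgebra R P (p ` carrier G) = carrier P"
    and H_submodule: "k \<in> carrier G \<Longrightarrow> submodule (H k) R P"
    and H_mult: "\<lbrakk>g \<in> carrier G; h \<in> carrier G; x \<in> H g; y \<in> H h\<rbrakk> \<Longrightarrow> x \<otimes> y \<in> H (g \<otimes>\<^bsub>G\<^esub> h)"
    and p_H: "g \<in> carrier G \<Longrightarrow> p g \<in> H g"
    and H_independent: "\<lbrakk>finite K; K \<subseteq> carrier G; \<And>k. k \<in> K \<Longrightarrow> f k \<in> H k; finsum P f K = \<zero>; k \<in> K\<rbrakk>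
      \<Longrightarrow> f k = \<zero>"
begin

text \<open>Each eps_g has degree g g^-1 = e, so a coefficient from \<open>E\<close> in front of [g]
  does not change the degree.\<close>

lemma E_H: "x \<in> E \<Longrightarrow> x \<in> H \<one>\<^bsub>G\<^esub>"
proof (induction rule: E_induct)
  case (gen s)
  then obtain g where "g \<in> carrier G" "s = eps g" by auto
  then show ?case
    using H_mult[of g "inv\<^bsub>G\<^esub> g" "p g" "p (inv\<^bsub>G\<^esub> g)"] p_H by (simp add: eps_def)
next
  case one
  then show ?case
    using p_H[of "\<one>\<^bsub>G\<^esub>"] by (simp add: p_one)
next
  case (mult x y)
  then show ?case
    using H_mult[of "\<one>\<^bsub>G\<^esub>" "\<one>\<^bsub>G\<^esub>" x y] by simp
qed (use P.submoduleE[OF H_submodule[of "\<one>\<^bsub>G\<^esub>"]] in auto)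

section \<open>The partial skew group ring and the map \<open>\<Psi>\<close>\<close>

context
  fixes \<theta> :: "'g \<Rightarrow> 'a \<Rightarrow> 'a"
  assumes \<theta>: "\<And>g x. g \<in> carrier G \<Longrightarrow> x \<in> D (inv\<^bsub>G\<^esub> g) \<Longrightarrow> \<theta> g x = conjugate g x"
begin

abbreviation S where "S \<equiv> partial_skew_group_ring G EA D \<theta>"

definition \<Psi> where "\<Psi> f = (\<Oplus>g\<in>{g. f g \<noteq> \<zero>}. f g \<otimes> p g)"

lemma S_carrier: "f \<in> carrier S \<longleftrightarrow>
    (\<forall>g\<in>carrier G. f g \<in> D g) \<and> (\<forall>g. g \<notin> carrier G \<longrightarrow> f g = \<zero>) \<and> finite {g. f g \<noteq> \<zero>}"
  by (simp add: partial_skew_group_ring_def)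

lemma S_simps:
  "(f \<oplus>\<^bsub>S\<^esub> f') g = f g \<oplus> f' g" "(r \<odot>\<^bsub>S\<^esub> f) g = r \<odot> f g" "\<zero>\<^bsub>S\<^esub> g = \<zero>" "\<one>\<^bsub>S\<^esub> = skew_elem EA \<one> \<one>\<^bsub>G\<^esub>"
  by (simp_all add: partial_skew_group_ring_def)

lemma S_D: "f \<in> carrier S \<Longrightarrow> g \<in> carrier G \<Longrightarrow> f g \<in> D g"
  by (simp add: S_carrier)

lemma S_E [simp]: "f \<in> carrier S \<Longrightarrow> f g \<in> E"
  by (cases "g \<in> carrier G") (auto simp: S_carrier D_E)

lemma S_supp_carrier: "f \<in> carrier S \<Longrightarrow> {g. f g \<noteq> \<zero>} \<subseteq> carrier G"
  by (auto simp: S_carrier)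

lemma S_closed:
  "\<zero>\<^bsub>S\<^esub> \<in> carrier S"
  "f \<in> carrier S \<Longrightarrow> f' \<in> carrier S \<Longrightarrow> f \<oplus>\<^bsub>S\<^esub> f' \<in> carrier S"
  "r \<in> carrier R \<Longrightarrow> f \<in> carrier S \<Longrightarrow> r \<odot>\<^bsub>S\<^esub> f \<in> carrier S"
proof -
  show "\<zero>\<^bsub>S\<^esub> \<in> carrier S"
    by (simp add: S_carrier S_simps D_closed)
  show "f \<oplus>\<^bsub>S\<^esub> f' \<in> carrier S" if "f \<in> carrier S" "f' \<in> carrier S"
  proof -
    have "{g. f g \<oplus> f' g \<noteq> \<zero>} \<subseteq> {g. f g \<noteq> \<zero>} \<union> {g. f' g \<noteq> \<zero>}"
      by auto
    then show ?thesis
      using that finite_subset[of "{g. f g \<oplus> f' g \<noteq> \<zero>}"] by (auto simp: S_carrier S_simps D_closed)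
  qed
  show "r \<odot>\<^bsub>S\<^esub> f \<in> carrier S" if "r \<in> carrier R" "f \<in> carrier S"
  proof -
    have "{g. r \<odot> f g \<noteq> \<zero>} \<subseteq> {g. f g \<noteq> \<zero>}"
      using that by auto
    then show ?thesis
      using that finite_subset[of "{g. r \<odot> f g \<noteq> \<zero>}"] by (auto simp: S_carrier S_simps D_closed)
  qed
qed

lemma skew_elem_S: "g \<in> carrier G \<Longrightarrow> a \<in> D g \<Longrightarrow> skew_elem EA a g \<in> carrier S"
  by (auto simp: S_carrier skew_elem_def D_closed)

text \<open>The index set of \<open>\<Psi>\<close> depends on its argument; comparing several
  elements requires a common finite set.\<close>

lemma \<Psi>_eq:
  assumes "f \<in> carrier S" "finite K" "K \<subseteq> carrier G" "{g. f g \<noteq> \<zero>} \<subseteq> K"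
  shows "\<Psi> f = (\<Oplus>g\<in>K. f g \<otimes> p g)"
  unfolding \<Psi>_def using assms
  by (intro P.add.finprod_mono_neutral_cong_left) auto

lemma \<Psi>_closed: "f \<in> carrier S \<Longrightarrow> \<Psi> f \<in> carrier P"
  unfolding \<Psi>_def using S_supp_carrier[of f] by (intro P.finsum_closed) auto

lemma \<Psi>_skew_elem:
  assumes "g \<in> carrier G" "a \<in> D g"
  shows "\<Psi> (skew_elem EA a g) = a \<otimes> p g"
  using assms D_carrier skew_elem_S[OF assms]
  by (subst \<Psi>_eq[of _ "{g}"]) (auto simp: skew_elem_def P.finsum_insert)

lemma \<Psi>_zero: "\<Psi> \<zero>\<^bsub>S\<^esub> = \<zero>"
  by (simp add: \<Psi>_def S_simps P.finsum_empty)

lemma \<Psi>_one: "\<Psi> \<one>\<^bsub>S\<^esub> = \<one>"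
  by (simp add: S_simps \<Psi>_skew_elem D_one p_one)

lemma \<Psi>_add:
  assumes "f \<in> carrier S" "f' \<in> carrier S"
  shows "\<Psi> (f \<oplus>\<^bsub>S\<^esub> f') = \<Psi> f \<oplus> \<Psi> f'"
proof -
  let ?K = "{g. f g \<noteq> \<zero>} \<union> {g. f' g \<noteq> \<zero>}"
  have K: "finite ?K" "?K \<subseteq> carrier G"
    using assms by (auto simp: S_carrier)
  have "\<Psi> (f \<oplus>\<^bsub>S\<^esub> f') = (\<Oplus>g\<in>?K. (f g \<oplus> f' g) \<otimes> p g)"
    using assms K by (subst \<Psi>_eq[of _ ?K]) (auto simp: S_closed S_simps)
  also have "\<dots> = (\<Oplus>g\<in>?K. f g \<otimes> p g \<oplus> f' g \<otimes> p g)"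
    using assms K by (intro P.finsum_cong') (auto simp: P.l_distr)
  also have "\<dots> = (\<Oplus>g\<in>?K. f g \<otimes> p g) \<oplus> (\<Oplus>g\<in>?K. f' g \<otimes> p g)"
    using assms K by (intro P.finsum_addf) auto
  also have "\<dots> = \<Psi> f \<oplus> \<Psi> f'"
    using assms K by (subst (1 2) \<Psi>_eq[of _ ?K]) auto
  finally show ?thesis .
qed

lemma \<Psi>_smult:
  assumes "r \<in> carrier R" "f \<in> carrier S"
  shows "\<Psi> (r \<odot>\<^bsub>S\<^esub> f) = r \<odot> \<Psi> f"
proof -
  let ?K = "{g. f g \<noteq> \<zero>}"
  have K: "finite ?K" "?K \<subseteq> carrier G"
    using assms by (auto simp: S_carrier)
  have "\<Psi> (r \<odot>\<^bsub>S\<^esub> f) = (\<Oplus>g\<in>?K. (r \<odot> f g) \<otimes> p g)"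
    using assms K by (subst \<Psi>_eq[of _ ?K]) (auto simp: S_closed S_simps)
  also have "\<dots> = (\<Oplus>g\<in>?K. r \<odot> (f g \<otimes> p g))"
    using assms K by (intro P.finsum_cong') (auto simp: P.smult_mult_left)
  also have "\<dots> = r \<odot> \<Psi> f"
    unfolding \<Psi>_def using assms K by (intro P.finsum_smult_ldistr[symmetric]) auto
  finally show ?thesis .
qed

lemma \<Psi>_kernel:
  assumes "f \<in> carrier S" "\<Psi> f = \<zero>"
  shows "f g = \<zero>"
proof (rule ccontr)
  assume g: "f g \<noteq> \<zero>"
  then have gG: "g \<in> carrier G"
    using assms(1) by (auto simp: S_carrier)
  have "f g \<otimes> p g = \<zero>"
  proof (rule H_independent[of "{g. f g \<noteq> \<zero>}" "\<lambda>g. f g \<otimes> p g"])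
    fix k assume "k \<in> {g. f g \<noteq> \<zero>}"
    then have "k \<in> carrier G"
      using assms(1) by (auto simp: S_carrier)
    then show "f k \<otimes> p k \<in> H k"
      using H_mult[of "\<one>\<^bsub>G\<^esub>" k "f k" "p k"] assms(1) p_H by (simp add: E_H)
  qed (use assms g in \<open>auto simp: S_carrier \<Psi>_def\<close>)
  moreover have "f g = (f g \<otimes> p g) \<otimes> p (inv\<^bsub>G\<^esub> g)"
    using S_D[OF assms(1) gG] gG by (simp add: D_iff eps_def P.m_assoc)
  ultimately show False
    using g gG by simp
qed

text \<open>At this point the skew ring is not known to be a group, as that will be derived from
  this lemma. The difference is therefore formed with the scalar -1, and equality is read off
  coefficientwise in \<open>P\<close>.\<close>

lemma \<Psi>_inj: "inj_on \<Psi> (carrier S)"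
proof (rule inj_onI)
  fix f f' assume f: "f \<in> carrier S" "f' \<in> carrier S" "\<Psi> f = \<Psi> f'"
  let ?d = "f \<oplus>\<^bsub>S\<^esub> ((\<ominus>\<^bsub>R\<^esub> \<one>\<^bsub>R\<^esub>) \<odot>\<^bsub>S\<^esub> f')"
  have "\<Psi> ?d = \<zero>"
    using f \<Psi>_closed by (simp add: \<Psi>_add \<Psi>_smult S_closed P.smult_l_minus P.r_neg)
  then have "f g \<oplus> (\<ominus>\<^bsub>R\<^esub> \<one>\<^bsub>R\<^esub>) \<odot> f' g = \<zero>" for g
    using \<Psi>_kernel[of ?d g] f by (simp add: S_closed S_simps)
  then have "f g \<ominus> f' g = \<zero>" for g
    using f by (simp add: P.smult_l_minus P.minus_eq)
  then show "f = f'"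
    using f by (intro ext) (simp add: P.r_right_minus_eq)
qed

text \<open>Conjugation is multiplicative on \<open>E\<close>, so the skew product has the
  coefficient a ([g] b [g^-1]). Followed by [gh], the last factor [g^-1] turns into eps_(g^-1) [h],
  and this idempotent moves past \<open>b\<close> to be absorbed by [g].\<close>

lemma S_mult_term:
  assumes "g \<in> carrier G" "h \<in> carrier G" "a \<in> D g" "b \<in> D h"
  defines "t \<equiv> \<theta> g (\<theta> (inv\<^bsub>G\<^esub> g) a \<otimes> b)"
  shows "t \<in> D (g \<otimes>\<^bsub>G\<^esub> h)" "t \<otimes> p (g \<otimes>\<^bsub>G\<^esub> h) = (a \<otimes> p g) \<otimes> (b \<otimes> p h)"
proof -
  have ab: "a \<in> E" "b \<in> E" "eps g \<otimes> a = a" "eps h \<otimes> b = b"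
    using assms(1-4) E_commute[of a "eps g"] E_commute[of b "eps h"] by (auto simp: D_iff)
  have d: "conjugate (inv\<^bsub>G\<^esub> g) a \<in> D (inv\<^bsub>G\<^esub> g)"
    using assms ab by (intro conjugate_closed) auto
  \<comment> \<open>The argument of the outer map lies in D_(g^-1) because its first factor does and
    D_(g^-1) is an ideal.\<close>
  have t: "t = conjugate g (conjugate (inv\<^bsub>G\<^esub> g) a \<otimes> b)"
    using assms ab d by (simp add: t_def \<theta> D_closed)
  show "t \<in> D (g \<otimes>\<^bsub>G\<^esub> h)"
    unfolding t using assms d D_E[of "inv\<^bsub>G\<^esub> g"] by (intro conjugate_D_Int) (auto simp: D_closed)
  have "conjugate g (conjugate (inv\<^bsub>G\<^esub> g) a) = a"
    using assms conjugate_inv_conjugate[of "inv\<^bsub>G\<^esub> g" a] by simp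
  then have "t = a \<otimes> conjugate g b"
    unfolding t using assms ab d D_E[of "inv\<^bsub>G\<^esub> g"] by (simp add: conjugate_mult)
  then have "t \<otimes> p (g \<otimes>\<^bsub>G\<^esub> h) = a \<otimes> (p g \<otimes> b \<otimes> (p (inv\<^bsub>G\<^esub> g) \<otimes> p (g \<otimes>\<^bsub>G\<^esub> h)))"
    using assms ab by (simp add: conjugate_def P.m_assoc)
  also have "p (inv\<^bsub>G\<^esub> g) \<otimes> p (g \<otimes>\<^bsub>G\<^esub> h) = eps (inv\<^bsub>G\<^esub> g) \<otimes> p h"
    using assms p_left[of g h] by (simp add: eps_def)
  also have "p g \<otimes> b \<otimes> (eps (inv\<^bsub>G\<^esub> g) \<otimes> p h) = p g \<otimes> (b \<otimes> eps (inv\<^bsub>G\<^esub> g)) \<otimes> p h"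
    using assms ab by (simp add: P.m_assoc)
  also have "b \<otimes> eps (inv\<^bsub>G\<^esub> g) = eps (inv\<^bsub>G\<^esub> g) \<otimes> b"
    using assms ab by (simp add: E_commute)
  also have "p g \<otimes> (eps (inv\<^bsub>G\<^esub> g) \<otimes> b) = p g \<otimes> b"
    using assms ab p_eps_inv by (simp add: P.m_assoc[symmetric])
  finally show "t \<otimes> p (g \<otimes>\<^bsub>G\<^esub> h) = (a \<otimes> p g) \<otimes> (b \<otimes> p h)"
    using assms ab by (simp add: P.m_assoc)
qed

lemma finsum_D:
  assumes "k \<in> carrier G" "\<And>x. x \<in> X \<Longrightarrow> f x \<in> D k"
  shows "finsum P f X \<in> D k"
  using assms(2)
proof (induction X rule: infinite_finite_induct)
  case (insert x X)
  then show ?case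
    using assms(1) D_carrier by (subst P.finsum_insert) (auto simp: D_closed)
qed (use assms(1) in \<open>simp_all add: D_closed P.finsum_infinite P.finsum_empty\<close>)

text \<open>Both claims rest on one description: the coefficient of the product at \<open>k\<close>
  is a sum over the pairs in the two supports with product \<open>k\<close>. These fibres vanish off
  the finite set \<open>K\<close>.\<close>

lemma
  assumes f: "f \<in> carrier S" "f' \<in> carrier S"
  shows S_mult_closed: "f \<otimes>\<^bsub>S\<^esub> f' \<in> carrier S"
    and \<Psi>_mult: "\<Psi> (f \<otimes>\<^bsub>S\<^esub> f') = \<Psi> f \<otimes> \<Psi> f'"
proof -
  define U V where "U = {g. f g \<noteq> \<zero>}" and "V = {h. f' h \<noteq> \<zero>}"
  define \<mu> where "\<mu> = (\<lambda>(g, h). g \<otimes>\<^bsub>G\<^esub> h)"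
  define t where "t = (\<lambda>(g, h). \<theta> g (\<theta> (inv\<^bsub>G\<^esub> g) (f g) \<otimes> f' h))"
  define K where "K = \<mu> ` (U \<times> V)"
  have UV: "finite U" "finite V" "U \<subseteq> carrier G" "V \<subseteq> carrier G"
    using f by (auto simp: U_def V_def S_carrier)
  have K: "finite K" "K \<subseteq> carrier G"
    using UV by (auto simp: K_def \<mu>_def)
  have t: "t x \<in> D (\<mu> x)" "t x \<otimes> p (\<mu> x) = (f (fst x) \<otimes> p (fst x)) \<otimes> (f' (snd x) \<otimes> p (snd x))"
    if x: "x \<in> U \<times> V" for x
  proof -
    obtain g h where "x = (g, h)" "g \<in> carrier G" "h \<in> carrier G"
      using x UV by auto
    then show "t x \<in> D (\<mu> x)"
      "t x \<otimes> p (\<mu> x) = (f (fst x) \<otimes> p (fst x)) \<otimes> (f' (snd x) \<otimes> p (snd x))"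
      using S_mult_term[of g h "f g" "f' h"] f S_D by (simp_all add: t_def \<mu>_def)
  qed
  have tE: "t x \<in> E" "\<mu> x \<in> carrier G" if "x \<in> U \<times> V" for x
    using that t(1)[OF that] UV D_E[of "\<mu> x"] by (auto simp: \<mu>_def)
  have E_monoid: "abelian_monoid EA"
    using E_r_algebra unfolding r_algebra_def ring_def abelian_group_def by auto
  \<comment> \<open>The sum is taken out of \<open>A_par\<close> into the whole algebra, where it
    can be multiplied by generators.\<close>
  have mult: "(f \<otimes>\<^bsub>S\<^esub> f') k = (\<Oplus>x\<in>{x \<in> U \<times> V. \<mu> x = k}. t x)" for k
  proof -
    have "(f \<otimes>\<^bsub>S\<^esub> f') k = finsum EA t {x \<in> U \<times> V. \<mu> x = k}"
      unfolding partial_skew_group_ring_def t_def U_def V_def \<mu>_def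
      using f S_supp_carrier by (auto intro!: arg_cong2[where f = "finsum EA"])
    also have "\<dots> = finsum P t {x \<in> U \<times> V. \<mu> x = k}"
      using tE by (intro P.finsum_subcarrier E_monoid) auto
    finally show ?thesis .
  qed
  have zero: "(f \<otimes>\<^bsub>S\<^esub> f') k = \<zero>" if "k \<notin> K" for k
  proof -
    have "{x \<in> U \<times> V. \<mu> x = k} = {}"
      using that by (auto simp: K_def)
    then show ?thesis
      by (simp only: mult P.finsum_empty)
  qed
  show S: "f \<otimes>\<^bsub>S\<^esub> f' \<in> carrier S"
    unfolding S_carrier
  proof (intro conjI ballI allI impI)
    fix k assume "k \<in> carrier G"
    then show "(f \<otimes>\<^bsub>S\<^esub> f') k \<in> D k"
      unfolding mult using t(1) by (intro finsum_D) auto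
  next
    fix k assume "k \<notin> carrier G"
    then show "(f \<otimes>\<^bsub>S\<^esub> f') k = \<zero>"
      using K by (intro zero) auto
  next
    show "finite {k. (f \<otimes>\<^bsub>S\<^esub> f') k \<noteq> \<zero>}"
      using zero by (intro finite_subset[OF _ K(1)]) auto
  qed
  define u v where "u = (\<lambda>g. f g \<otimes> p g)" and "v = (\<lambda>h. f' h \<otimes> p h)"
  have uv: "u \<in> U \<rightarrow> carrier P" "v \<in> V \<rightarrow> carrier P"
    using f UV by (auto simp: u_def v_def)
  have tuv: "t x \<otimes> p (\<mu> x) = u (fst x) \<otimes> v (snd x)" if "x \<in> U \<times> V" for x
    using t(2)[OF that] by (simp add: u_def v_def)
  have "\<Psi> (f \<otimes>\<^bsub>S\<^esub> f') = (\<Oplus>k\<in>K. (f \<otimes>\<^bsub>S\<^esub> f') k \<otimes> p k)"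
    using S K zero by (intro \<Psi>_eq) auto
  also have "\<dots> = (\<Oplus>k\<in>K. \<Oplus>x\<in>{x \<in> U \<times> V. \<mu> x = k}. t x \<otimes> p (\<mu> x))"
  proof (rule P.finsum_cong')
    fix k assume "k \<in> K"
    then have "(f \<otimes>\<^bsub>S\<^esub> f') k \<otimes> p k = (\<Oplus>x\<in>{x \<in> U \<times> V. \<mu> x = k}. t x \<otimes> p k)"
      unfolding mult using K UV tE by (intro P.finsum_ldistr) auto
    also have "\<dots> = (\<Oplus>x\<in>{x \<in> U \<times> V. \<mu> x = k}. t x \<otimes> p (\<mu> x))"
      using tE by (intro P.finsum_cong') auto
    finally show "(f \<otimes>\<^bsub>S\<^esub> f') k \<otimes> p k = (\<Oplus>x\<in>{x \<in> U \<times> V. \<mu> x = k}. t x \<otimes> p (\<mu> x))" .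
  qed (use tE in \<open>auto intro!: P.finsum_closed\<close>)
  also have "\<dots> = (\<Oplus>x\<in>U \<times> V. t x \<otimes> p (\<mu> x))"
    using UV K tE by (intro P.finsum_fibres) (auto simp: K_def)
  also have "\<dots> = finsum P (\<lambda>(g, h). u g \<otimes> v h) (U \<times> V)"
    using uv tuv by (intro P.finsum_cong') (auto intro!: P.m_closed)
  also have "\<dots> = (\<Oplus>g\<in>U. \<Oplus>h\<in>V. u g \<otimes> v h)"
    using UV uv by (intro P.finsum_Sigma[symmetric]) (auto intro!: P.m_closed)
  also have "\<dots> = (\<Oplus>g\<in>U. u g \<otimes> (\<Oplus>h\<in>V. v h))"
    using UV uv by (intro P.finsum_cong' P.finsum_rdistr[symmetric]) (auto intro!: P.m_closed P.finsum_closed)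
  also have "\<dots> = (\<Oplus>g\<in>U. u g) \<otimes> (\<Oplus>h\<in>V. v h)"
    using UV uv by (intro P.finsum_ldistr[symmetric]) (auto intro!: P.finsum_closed)
  finally show "\<Psi> (f \<otimes>\<^bsub>S\<^esub> f') = \<Psi> f \<otimes> \<Psi> f'"
    by (simp add: \<Psi>_def U_def V_def u_def v_def)
qed

lemma S_one_closed: "\<one>\<^bsub>S\<^esub> \<in> carrier S"
  by (simp add: S_simps skew_elem_S D_one)

lemma S_r_algebra: "r_algebra R S"
  by (rule r_algebra_pullback[OF P.r_algebra_axioms, of \<Psi>])
    (auto simp: \<Psi>_closed \<Psi>_inj S_closed S_one_closed S_mult_closed \<Psi>_zero \<Psi>_one \<Psi>_add \<Psi>_mult \<Psi>_smult)

lemma \<Psi>_eps: "g \<in> carrier G \<Longrightarrow> \<Psi> (skew_elem EA (eps g) g) = p g"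
  by (simp add: \<Psi>_skew_elem D_closed eps_p)

lemma \<Psi>_bij: "bij_betw \<Psi> (carrier S) (carrier P)"
proof (rule bij_betw_imageI[OF \<Psi>_inj], intro equalityI subsetI)
  fix x assume "x \<in> carrier P"
  then have "x \<in> generated_subalgebra R P (p ` carrier G)"
    by (simp add: generating)
  moreover have "p ` carrier G \<subseteq> carrier P"
    by auto
  ultimately show "x \<in> \<Psi> ` carrier S"
  proof (induction rule: P.generated_subalgebra_induct)
    case (gen s)
    then obtain g where "g \<in> carrier G" "s = \<Psi> (skew_elem EA (eps g) g)"
      using \<Psi>_eps by auto
    then show ?case
      by (auto intro!: imageI skew_elem_S D_closed)
  next
    case one
    then show ?case
      using S_one_closed \<Psi>_one by (metis imageI)
  next
    case (add x y)
    then show ?case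
      by (auto simp: \<Psi>_add[symmetric] S_closed)
  next
    case (mult x y)
    then show ?case
      by (auto simp: \<Psi>_mult[symmetric] S_mult_closed)
  next
    case (smult r x)
    then show ?case
      by (auto simp: \<Psi>_smult[symmetric] S_closed)
  qed
qed (use \<Psi>_closed in auto)

section \<open>The isomorphism as inverse of \<open>\<Psi>\<close>, and its uniqueness\<close>

definition \<Phi>\<^sub>0 where "\<Phi>\<^sub>0 = restrict (inv_into (carrier S) \<Psi>) (carrier P)"

lemma \<Phi>\<^sub>0_\<Psi>: "f \<in> carrier S \<Longrightarrow> \<Phi>\<^sub>0 (\<Psi> f) = f"
  by (simp add: \<Phi>\<^sub>0_def \<Psi>_closed \<Psi>_inj)

lemma \<Phi>\<^sub>0_hom: "\<Phi>\<^sub>0 \<in> unital_alg_hom R P S"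
proof -
  \<comment> \<open>With every argument written as a value of \<open>\<Psi>\<close>, the laws for
    the inverse become those of \<open>\<Psi>\<close>.\<close>
  have P: "carrier P = \<Psi> ` carrier S"
    using \<Psi>_bij by (simp add: bij_betw_def)
  show ?thesis
    unfolding unital_alg_hom_def alg_hom_def P
    using \<Phi>\<^sub>0_\<Psi>[OF S_one_closed]
    by (auto simp: \<Phi>\<^sub>0_\<Psi> S_closed S_mult_closed \<Psi>_one
      simp flip: \<Psi>_add \<Psi>_mult \<Psi>_smult)
qed

lemma \<Phi>\<^sub>0_bij: "bij_betw \<Phi>\<^sub>0 (carrier P) (carrier S)"
  using bij_betw_inv_into[OF \<Psi>_bij] by (simp add: \<Phi>\<^sub>0_def)

lemma \<Phi>\<^sub>0_p: "g \<in> carrier G \<Longrightarrow> \<Phi>\<^sub>0 (p g) = skew_elem EA (eps g) g"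
  using \<Phi>\<^sub>0_\<Psi>[of "skew_elem EA (eps g) g"] by (simp add: \<Psi>_eps skew_elem_S D_closed)

lemma hom_eq_\<Phi>\<^sub>0:
  assumes "\<Phi> \<in> unital_alg_hom R P S" "\<And>g. g \<in> carrier G \<Longrightarrow> \<Phi> (p g) = skew_elem EA (eps g) g"
    and "x \<in> carrier P"
  shows "\<Phi> x = \<Phi>\<^sub>0 x"
  by (rule unital_alg_hom_unique[OF P.r_algebra_axioms S_r_algebra assms(1) \<Phi>\<^sub>0_hom, of "p ` carrier G"])
    (use assms \<Phi>\<^sub>0_p generating in auto)

lemma skew_hom_ex1:
  "\<exists>!\<Phi>. \<Phi> \<in> unital_alg_hom R P S \<inter> extensional (carrier P) \<and>
     (\<forall>g\<in>carrier G. \<Phi> (p g) = skew_elem EA (eps g) g)"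
proof (rule ex1I[of _ \<Phi>\<^sub>0])
  show "\<Phi>\<^sub>0 \<in> unital_alg_hom R P S \<inter> extensional (carrier P) \<and>
      (\<forall>g\<in>carrier G. \<Phi>\<^sub>0 (p g) = skew_elem EA (eps g) g)"
    using \<Phi>\<^sub>0_hom \<Phi>\<^sub>0_p by (auto simp: \<Phi>\<^sub>0_def)
next
  fix \<Phi>
  assume "\<Phi> \<in> unital_alg_hom R P S \<inter> extensional (carrier P) \<and>
      (\<forall>g\<in>carrier G. \<Phi> (p g) = skew_elem EA (eps g) g)"
  then show "\<Phi> = \<Phi>\<^sub>0"
    using hom_eq_\<Phi>\<^sub>0 by (intro extensionalityI[where A = "carrier P"]) (auto simp: \<Phi>\<^sub>0_def)
qed

text \<open>Outside the carrier of \<open>P\<close> such a map may take any values, so bijectivity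
  is transferred from \<open>\<Phi>\<^sub>0\<close> by agreement on the carrier.\<close>

lemma skew_hom_iso:
  assumes "\<Phi> \<in> unital_alg_hom R P S" "\<And>g. g \<in> carrier G \<Longrightarrow> \<Phi> (p g) = skew_elem EA (eps g) g"
  shows "\<Phi> \<in> unital_alg_iso R P S"
  using assms hom_eq_\<Phi>\<^sub>0[OF assms] \<Phi>\<^sub>0_bij bij_betw_cong[of "carrier P" \<Phi> \<Phi>\<^sub>0] S_r_algebra P.r_algebra_axioms
  by (auto simp: unital_alg_iso_def)

end

end

section \<open>Quotient algebras\<close>

context r_algebra
begin

text \<open>A scalar multiple of x is the ring product of r 1 with x.\<close>

lemma ideal_smult_closed:
  assumes "ideal I A" "r \<in> carrier R" "x \<in> I"
  shows "r \<odot>\<^bsub>A\<^esub> x \<in> I"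
proof -
  interpret I: ideal I A by fact
  have "(r \<odot>\<^bsub>A\<^esub> \<one>\<^bsub>A\<^esub>) \<otimes>\<^bsub>A\<^esub> x \<in> I"
    using assms by (intro I.I_l_closed) auto
  then show ?thesis
    using assms I.a_subset by (simp add: smult_mult_left subset_iff)
qed

lemma
  assumes I: "ideal I A"
  shows quotient_algebra_carrier: "carrier (quotient_algebra A I) = (\<lambda>x. I +>\<^bsub>A\<^esub> x) ` carrier A"
    and quotient_algebra_zero: "\<zero>\<^bsub>quotient_algebra A I\<^esub> = I +>\<^bsub>A\<^esub> \<zero>\<^bsub>A\<^esub>"
    and quotient_algebra_one: "\<one>\<^bsub>quotient_algebra A I\<^esub> = I +>\<^bsub>A\<^esub> \<one>\<^bsub>A\<^esub>"
    and quotient_algebra_add: "\<lbrakk>x \<in> carrier A; y \<in> carrier A\<rbrakk> \<Longrightarrow>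
      (I +>\<^bsub>A\<^esub> x) \<oplus>\<^bsub>quotient_algebra A I\<^esub> (I +>\<^bsub>A\<^esub> y) = I +>\<^bsub>A\<^esub> (x \<oplus>\<^bsub>A\<^esub> y)"
    and quotient_algebra_mult: "\<lbrakk>x \<in> carrier A; y \<in> carrier A\<rbrakk> \<Longrightarrow>
      (I +>\<^bsub>A\<^esub> x) \<otimes>\<^bsub>quotient_algebra A I\<^esub> (I +>\<^bsub>A\<^esub> y) = I +>\<^bsub>A\<^esub> (x \<otimes>\<^bsub>A\<^esub> y)"
    and quotient_algebra_smult: "\<lbrakk>r \<in> carrier R; x \<in> carrier A\<rbrakk> \<Longrightarrow>
      r \<odot>\<^bsub>quotient_algebra A I\<^esub> (I +>\<^bsub>A\<^esub> x) = I +>\<^bsub>A\<^esub> (r \<odot>\<^bsub>A\<^esub> x)"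
proof -
  interpret I: ideal I A by fact
  show "carrier (quotient_algebra A I) = (\<lambda>x. I +>\<^bsub>A\<^esub> x) ` carrier A"
    by (auto simp: quotient_algebra_def FactRing_def A_RCOSETS_def')
  show "\<zero>\<^bsub>quotient_algebra A I\<^esub> = I +>\<^bsub>A\<^esub> \<zero>\<^bsub>A\<^esub>"
    by (simp add: quotient_algebra_def FactRing_def I.a_rcos_const)
  show "\<one>\<^bsub>quotient_algebra A I\<^esub> = I +>\<^bsub>A\<^esub> \<one>\<^bsub>A\<^esub>"
    by (simp add: quotient_algebra_def FactRing_def)
  show "(I +>\<^bsub>A\<^esub> x) \<oplus>\<^bsub>quotient_algebra A I\<^esub> (I +>\<^bsub>A\<^esub> y) = I +>\<^bsub>A\<^esub> (x \<oplus>\<^bsub>A\<^esub> y)"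
    if "x \<in> carrier A" "y \<in> carrier A"
    using that by (simp add: quotient_algebra_def FactRing_def I.a_rcos_sum)
  show "(I +>\<^bsub>A\<^esub> x) \<otimes>\<^bsub>quotient_algebra A I\<^esub> (I +>\<^bsub>A\<^esub> y) = I +>\<^bsub>A\<^esub> (x \<otimes>\<^bsub>A\<^esub> y)"
    if "x \<in> carrier A" "y \<in> carrier A"
    using that by (simp add: quotient_algebra_def FactRing_def I.rcoset_mult_add)
  show "r \<odot>\<^bsub>quotient_algebra A I\<^esub> (I +>\<^bsub>A\<^esub> x) = I +>\<^bsub>A\<^esub> (r \<odot>\<^bsub>A\<^esub> x)"
    if r: "r \<in> carrier R" and x: "x \<in> carrier A"
  proof -
    \<comment> \<open>The scalar action on cosets is a union over all representatives; it is a
      single coset because each representative contributes the same one.\<close>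
    have "I +>\<^bsub>A\<^esub> (r \<odot>\<^bsub>A\<^esub> z) = I +>\<^bsub>A\<^esub> (r \<odot>\<^bsub>A\<^esub> x)" if z: "z \<in> I +>\<^bsub>A\<^esub> x" for z
    proof -
      obtain i where i: "i \<in> I" "z = i \<oplus>\<^bsub>A\<^esub> x"
        using z by (auto simp: a_r_coset_def')
      then have "i \<in> carrier A"
        using I.a_subset by auto
      then have "r \<odot>\<^bsub>A\<^esub> z = r \<odot>\<^bsub>A\<^esub> i \<oplus>\<^bsub>A\<^esub> r \<odot>\<^bsub>A\<^esub> x"
        using r x i by (simp add: smult_r_distr)
      then have "r \<odot>\<^bsub>A\<^esub> z \<in> I +>\<^bsub>A\<^esub> (r \<odot>\<^bsub>A\<^esub> x)"
        using ideal_smult_closed[OF I r i(1)] by (auto simp: a_r_coset_def')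
      then show ?thesis
        using r x I.a_subgroup by (intro M.a_repr_independence[symmetric]) auto
    qed
    then have "(\<Union>z\<in>I +>\<^bsub>A\<^esub> x. I +>\<^bsub>A\<^esub> (r \<odot>\<^bsub>A\<^esub> z)) = I +>\<^bsub>A\<^esub> (r \<odot>\<^bsub>A\<^esub> x)"
      using I.a_rcos_self[OF x] by blast
    then show ?thesis
      by (simp add: quotient_algebra_def)
  qed
qed

lemma r_algebra_quotient: "ideal I A \<Longrightarrow> r_algebra R (quotient_algebra A I)"
  by (rule r_algebra_image[OF r_algebra_axioms, of "\<lambda>x. I +>\<^bsub>A\<^esub> x"])
    (simp_all add: quotient_algebra_carrier quotient_algebra_zero quotient_algebra_one
      quotient_algebra_add quotient_algebra_mult quotient_algebra_smult)

end

section \<open>Free algebras\<close>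

text \<open>A splitting of a word is determined by the length of its first part.\<close>

lemma finite_splits [simp]: "finite {(u, v). u @ v = w}"
proof (rule finite_subset)
  show "{(u, v). u @ v = w} \<subseteq> (\<lambda>i. (take i w, drop i w)) ` {..length w}"
  proof clarify
    fix u v assume "w = u @ v"
    then show "(u, v) \<in> (\<lambda>i. (take i (u @ v), drop i (u @ v))) ` {..length (u @ v)}"
      by (intro image_eqI[of _ _ "length u"]) auto
  qed
qed simp

lemma finite_splits' [simp]: "finite {x. fst x @ snd x = w}"
  using finite_splits[of w] by (simp add: case_prod_beta')

text \<open>The basis vectors of the free algebra; words of length 0 and 1 give the unit and the
  free generators.\<close>

definition free_word :: "('r, 'p) ring_scheme \<Rightarrow> 'x list \<Rightarrow> 'x list \<Rightarrow> 'r"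
  where "free_word R u = (\<lambda>w. if w = u then \<one>\<^bsub>R\<^esub> else \<zero>\<^bsub>R\<^esub>)"

context cring
begin

lemma free_algebra_carrier: "f \<in> carrier (free_algebra R B) \<longleftrightarrow>
    (\<forall>w. f w \<in> carrier R) \<and> (\<forall>w. w \<notin> lists B \<longrightarrow> f w = \<zero>) \<and> finite {w. f w \<noteq> \<zero>}"
  by (auto simp: free_algebra_def Pi_def) (metis zero_closed)

lemma free_algebra_simps:
  "(f \<oplus>\<^bsub>free_algebra R B\<^esub> f') w = f w \<oplus> f' w"
  "(f \<otimes>\<^bsub>free_algebra R B\<^esub> f') w = finsum R (\<lambda>(u, v). f u \<otimes> f' v) {(u, v). u @ v = w}"
  "(r \<odot>\<^bsub>free_algebra R B\<^esub> f) w = r \<otimes> f w"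
  "\<zero>\<^bsub>free_algebra R B\<^esub> w = \<zero>"
  "\<one>\<^bsub>free_algebra R B\<^esub> = free_word R []"
  by (simp_all add: free_algebra_def free_word_def)

lemma free_algebra_closed:
  assumes f: "f \<in> carrier (free_algebra R B)" and f': "f' \<in> carrier (free_algebra R B)"
  shows "f \<oplus>\<^bsub>free_algebra R B\<^esub> f' \<in> carrier (free_algebra R B)"
    and "f \<otimes>\<^bsub>free_algebra R B\<^esub> f' \<in> carrier (free_algebra R B)"
    and "r \<in> carrier R \<Longrightarrow> r \<odot>\<^bsub>free_algebra R B\<^esub> f \<in> carrier (free_algebra R B)"
proof -
  have fin: "finite {w. f w \<noteq> \<zero>}" "finite {w. f' w \<noteq> \<zero>}"
    using f f' by (auto simp: free_algebra_carrier)
  have "{w. f w \<oplus> f' w \<noteq> \<zero>} \<subseteq> {w. f w \<noteq> \<zero>} \<union> {w. f' w \<noteq> \<zero>}"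
    by auto
  then have "finite {w. f w \<oplus> f' w \<noteq> \<zero>}"
    using fin finite_subset by blast
  then show "f \<oplus>\<^bsub>free_algebra R B\<^esub> f' \<in> carrier (free_algebra R B)"
    using f f' by (auto simp: free_algebra_carrier free_algebra_simps)
  \<comment> \<open>Used twice: for finiteness of the support, and for vanishing outside the words
    over \<open>B\<close>.\<close>
  have zero: "(f \<otimes>\<^bsub>free_algebra R B\<^esub> f') w = \<zero>" if "\<And>u v. u @ v = w \<Longrightarrow> f u = \<zero> \<or> f' v = \<zero>" for w
  proof -
    have "f u \<otimes> f' v = \<zero>" if "u @ v = w" for u v
      using f f' \<open>\<And>u v. u @ v = w \<Longrightarrow> f u = \<zero> \<or> f' v = \<zero>\<close>[OF that] by (auto simp: free_algebra_carrier)
    then show ?thesis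
      unfolding free_algebra_simps by (intro add.finprod_one_eqI) auto
  qed
  have "{w. (f \<otimes>\<^bsub>free_algebra R B\<^esub> f') w \<noteq> \<zero>} \<subseteq> (\<lambda>(u, v). u @ v) ` ({w. f w \<noteq> \<zero>} \<times> {w. f' w \<noteq> \<zero>})"
  proof
    fix w assume "w \<in> {w. (f \<otimes>\<^bsub>free_algebra R B\<^esub> f') w \<noteq> \<zero>}"
    then obtain u v where "u @ v = w" "f u \<noteq> \<zero>" "f' v \<noteq> \<zero>"
      using zero[of w] by blast
    then show "w \<in> (\<lambda>(u, v). u @ v) ` ({w. f w \<noteq> \<zero>} \<times> {w. f' w \<noteq> \<zero>})"
      by (intro image_eqI[of _ _ "(u, v)"]) auto
  qed
  then have "finite {w. (f \<otimes>\<^bsub>free_algebra R B\<^esub> f') w \<noteq> \<zero>}"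
    using fin by (auto intro: finite_subset)
  moreover have "(f \<otimes>\<^bsub>free_algebra R B\<^esub> f') w = \<zero>" if w: "w \<notin> lists B" for w
  proof (rule zero)
    fix u v assume "u @ v = w"
    then have "u \<notin> lists B \<or> v \<notin> lists B"
      using w by auto
    then show "f u = \<zero> \<or> f' v = \<zero>"
      using f f' unfolding free_algebra_carrier by blast
  qed
  moreover have "(f \<otimes>\<^bsub>free_algebra R B\<^esub> f') w \<in> carrier R" for w
    using f f' unfolding free_algebra_simps by (intro finsum_closed) (auto simp: free_algebra_carrier)
  ultimately show "f \<otimes>\<^bsub>free_algebra R B\<^esub> f' \<in> carrier (free_algebra R B)"
    by (auto simp: free_algebra_carrier)
  show "r \<odot>\<^bsub>free_algebra R B\<^esub> f \<in> carrier (free_algebra R B)" if "r \<in> carrier R"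
  proof -
    have "{w. r \<otimes> f w \<noteq> \<zero>} \<subseteq> {w. f w \<noteq> \<zero>}"
      using that by auto
    then show ?thesis
      using that f fin finite_subset[of "{w. r \<otimes> f w \<noteq> \<zero>}"]
      by (auto simp: free_algebra_carrier free_algebra_simps)
  qed
qed

lemma free_word_carrier: "w \<in> lists B \<Longrightarrow> free_word R w \<in> carrier (free_algebra R B)"
  by (auto simp: free_algebra_carrier free_word_def)

text \<open>Both bracketings are reindexed to the same sum over the factorisations of
  \<open>w\<close> into three words.\<close>

lemma free_algebra_assoc:
  fixes B :: "'x set"
  assumes "f \<in> carrier (free_algebra R B)" "f' \<in> carrier (free_algebra R B)" "f'' \<in> carrier (free_algebra R B)"
  shows "(f \<otimes>\<^bsub>free_algebra R B\<^esub> f') \<otimes>\<^bsub>free_algebra R B\<^esub> f'' = f \<otimes>\<^bsub>free_algebra R B\<^esub> (f' \<otimes>\<^bsub>free_algebra R B\<^esub> f'')"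
    (is "?L = ?R")
proof
  fix w :: "'x list"
  define T where "T = {(a, b, c). a @ b @ c = w}"
  have c: "f u \<in> carrier R" "f' u \<in> carrier R" "f'' u \<in> carrier R" for u
    using assms by (auto simp: free_algebra_carrier)
  have "?L w = finsum R (\<lambda>x. finsum R (\<lambda>y. f (fst y) \<otimes> f' (snd y)) {(a, b). a @ b = fst x} \<otimes> f'' (snd x)) {(u, v). u @ v = w}"
    by (simp add: free_algebra_simps case_prod_beta')
  also have "\<dots> = finsum R (\<lambda>x. finsum R (\<lambda>y. f (fst y) \<otimes> f' (snd y) \<otimes> f'' (snd x)) {(a, b). a @ b = fst x}) {(u, v). u @ v = w}"
    using c by (intro finsum_cong' finsum_ldistr) (auto intro!: finsum_closed)
  also have "\<dots> = finsum R (\<lambda>(x, y). f (fst y) \<otimes> f' (snd y) \<otimes> f'' (snd x))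
      (Sigma {(u, v). u @ v = w} (\<lambda>x. {(a, b). a @ b = fst x}))"
    using c by (intro finsum_Sigma) auto
  also have "Sigma {(u, v). u @ v = w} (\<lambda>x. {(a, b). a @ b = fst x}) = (\<lambda>(a, b, c). ((a @ b, c), (a, b))) ` T"
    by (force simp: T_def)
  also have "finsum R (\<lambda>(x, y). f (fst y) \<otimes> f' (snd y) \<otimes> f'' (snd x)) \<dots>
      = finsum R (\<lambda>(a, b, d). f a \<otimes> f' b \<otimes> f'' d) T"
    using c by (subst finsum_reindex) (auto simp: inj_on_def case_prod_beta')
  finally have L: "?L w = finsum R (\<lambda>(a, b, d). f a \<otimes> f' b \<otimes> f'' d) T" .
  have "?R w = finsum R (\<lambda>x. f (fst x) \<otimes> finsum R (\<lambda>y. f' (fst y) \<otimes> f'' (snd y)) {(a, b). a @ b = snd x}) {(u, v). u @ v = w}"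
    by (simp add: free_algebra_simps case_prod_beta')
  also have "\<dots> = finsum R (\<lambda>x. finsum R (\<lambda>y. f (fst x) \<otimes> (f' (fst y) \<otimes> f'' (snd y))) {(a, b). a @ b = snd x}) {(u, v). u @ v = w}"
    using c by (intro finsum_cong' finsum_rdistr) (auto intro!: finsum_closed)
  also have "\<dots> = finsum R (\<lambda>(x, y). f (fst x) \<otimes> (f' (fst y) \<otimes> f'' (snd y)))
      (Sigma {(u, v). u @ v = w} (\<lambda>x. {(a, b). a @ b = snd x}))"
    using c by (intro finsum_Sigma) auto
  also have "Sigma {(u, v). u @ v = w} (\<lambda>x. {(a, b). a @ b = snd x}) = (\<lambda>(a, b, c). ((a, b @ c), (b, c))) ` T"
    by (force simp: T_def)
  also have "finsum R (\<lambda>(x, y). f (fst x) \<otimes> (f' (fst y) \<otimes> f'' (snd y))) \<dots>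
      = finsum R (\<lambda>(a, b, d). f a \<otimes> f' b \<otimes> f'' d) T"
    using c by (subst finsum_reindex) (auto simp: inj_on_def case_prod_beta' m_assoc)
  finally show "?L w = ?R w"
    using L by simp
qed

text \<open>A word has at most one splitting with the given word as prefix, or as suffix, so the
  convolution has at most one nonzero term.\<close>

lemma free_word_mult_apply:
  assumes "f \<in> carrier (free_algebra R B)"
  shows "(free_word R u \<otimes>\<^bsub>free_algebra R B\<^esub> f) (u @ v) = f v"
    and "(f \<otimes>\<^bsub>free_algebra R B\<^esub> free_word R u) (v @ u) = f v"
    and "\<nexists>v. w = u @ v \<Longrightarrow> (free_word R u \<otimes>\<^bsub>free_algebra R B\<^esub> f) w = \<zero>"
proof -
  have c: "f u \<in> carrier R" for u
    using assms by (auto simp: free_algebra_carrier)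
  show "(free_word R u \<otimes>\<^bsub>free_algebra R B\<^esub> f) (u @ v) = f v"
    unfolding free_algebra_simps
    by (subst finsum_single[of _ "(u, v)"]) (auto simp: free_word_def c split: if_splits)
  show "(f \<otimes>\<^bsub>free_algebra R B\<^esub> free_word R u) (v @ u) = f v"
    unfolding free_algebra_simps
    by (subst finsum_single[of _ "(v, u)"]) (auto simp: free_word_def c split: if_splits)
  show "(free_word R u \<otimes>\<^bsub>free_algebra R B\<^esub> f) w = \<zero>" if "\<nexists>v. w = u @ v"
    unfolding free_algebra_simps using that
    by (intro add.finprod_one_eqI) (auto simp: free_word_def c split: if_splits)
qed

lemma free_word_mult:
  assumes "v \<in> lists B"
  shows "free_word R u \<otimes>\<^bsub>free_algebra R B\<^esub> free_word R v = free_word R (u @ v)"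
proof
  fix w
  show "(free_word R u \<otimes>\<^bsub>free_algebra R B\<^esub> free_word R v) w = free_word R (u @ v) w"
  proof (cases "\<exists>z. w = u @ z")
    case True
    then obtain z where w: "w = u @ z" by blast
    then have "(free_word R u \<otimes>\<^bsub>free_algebra R B\<^esub> free_word R v) w = free_word R v z"
      by (simp add: free_word_mult_apply(1)[OF free_word_carrier[OF assms]])
    then show ?thesis
      by (simp add: w free_word_def[of R v] free_word_def[of R "u @ v"])
  next
    case False
    then have "(free_word R u \<otimes>\<^bsub>free_algebra R B\<^esub> free_word R v) w = \<zero>"
      by (intro free_word_mult_apply(3)[OF free_word_carrier[OF assms]])
    then show ?thesis
      using False by (auto simp: free_word_def[of R "u @ v"])
  qed
qed

lemma free_algebra_r_algebra: "r_algebra R (free_algebra R B)"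
proof -
  let ?F = "free_algebra R B"
  have c: "f w \<in> carrier R" if "f \<in> carrier ?F" for f w
    using that by (auto simp: free_algebra_carrier)
  have ag: "abelian_group ?F"
  proof (rule abelian_groupI)
    fix f assume f: "f \<in> carrier ?F"
    have "(\<lambda>w. \<ominus> f w) \<in> carrier ?F"
    proof -
      have "{w. \<ominus> f w \<noteq> \<zero>} \<subseteq> {w. f w \<noteq> \<zero>}"
        by auto
      then show ?thesis
        using f finite_subset[of "{w. \<ominus> f w \<noteq> \<zero>}"] by (auto simp: free_algebra_carrier)
    qed
    moreover have "(\<lambda>w. \<ominus> f w) \<oplus>\<^bsub>?F\<^esub> f = \<zero>\<^bsub>?F\<^esub>"
      using c[OF f] by (intro ext) (simp add: free_algebra_simps l_neg)
    ultimately show "\<exists>f'\<in>carrier ?F. f' \<oplus>\<^bsub>?F\<^esub> f = \<zero>\<^bsub>?F\<^esub>"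
      by blast
  next
    show "\<zero>\<^bsub>?F\<^esub> \<in> carrier ?F"
      by (simp add: free_algebra_carrier free_algebra_simps)
  qed (auto simp: free_algebra_closed free_algebra_simps c a_assoc a_comm a_lcomm intro!: ext)
  have one: "\<one>\<^bsub>?F\<^esub> \<in> carrier ?F"
    by (simp add: free_algebra_simps free_word_carrier)
  have monoid: "monoid ?F"
  proof (rule monoidI)
    fix f assume f: "f \<in> carrier ?F"
    show "\<one>\<^bsub>?F\<^esub> \<otimes>\<^bsub>?F\<^esub> f = f" "f \<otimes>\<^bsub>?F\<^esub> \<one>\<^bsub>?F\<^esub> = f"
      using free_word_mult_apply(1,2)[OF f, of "[]"] unfolding free_algebra_simps(5) by (auto intro!: ext)
  qed (simp_all add: one free_algebra_closed free_algebra_assoc)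
  have "ring ?F"
  proof (rule ringI[OF ag monoid])
    fix f f' f'' assume f: "f \<in> carrier ?F" "f' \<in> carrier ?F" "f'' \<in> carrier ?F"
    note [simp] = c[OF f(1)] c[OF f(2)] c[OF f(3)]
    show "(f \<oplus>\<^bsub>?F\<^esub> f') \<otimes>\<^bsub>?F\<^esub> f'' = f \<otimes>\<^bsub>?F\<^esub> f'' \<oplus>\<^bsub>?F\<^esub> f' \<otimes>\<^bsub>?F\<^esub> f''"
      by (intro ext) (simp add: free_algebra_simps case_prod_beta' l_distr Pi_def finsum_addf)
    show "f'' \<otimes>\<^bsub>?F\<^esub> (f \<oplus>\<^bsub>?F\<^esub> f') = f'' \<otimes>\<^bsub>?F\<^esub> f \<oplus>\<^bsub>?F\<^esub> f'' \<otimes>\<^bsub>?F\<^esub> f'"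
      by (intro ext) (simp add: free_algebra_simps case_prod_beta' r_distr Pi_def finsum_addf)
  qed
  moreover have "module R ?F"
    by (rule moduleI[OF is_cring ag])
      (auto simp: free_algebra_closed free_algebra_simps c l_distr r_distr m_assoc intro!: ext)
  moreover have "r_algebra_axioms R ?F"
  proof
    fix r f f' assume r: "r \<in> carrier R" and f: "f \<in> carrier ?F" "f' \<in> carrier ?F"
    note [simp] = r c[OF f(1)] c[OF f(2)]
    show "(r \<odot>\<^bsub>?F\<^esub> f) \<otimes>\<^bsub>?F\<^esub> f' = r \<odot>\<^bsub>?F\<^esub> (f \<otimes>\<^bsub>?F\<^esub> f')"
      by (intro ext) (simp add: free_algebra_simps case_prod_beta' finsum_rdistr m_assoc Pi_def)
    show "f \<otimes>\<^bsub>?F\<^esub> (r \<odot>\<^bsub>?F\<^esub> f') = r \<odot>\<^bsub>?F\<^esub> (f \<otimes>\<^bsub>?F\<^esub> f')"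
      by (intro ext) (simp add: free_algebra_simps case_prod_beta' finsum_rdistr m_lcomm Pi_def)
  qed
  ultimately show ?thesis
    by (intro r_algebra.intro)
qed

lemma free_gen_eq: "free_gen R x = free_word R [x]"
  by (simp add: free_gen_def free_word_def)

lemma free_gen_carrier: "x \<in> B \<Longrightarrow> free_gen R x \<in> carrier (free_algebra R B)"
  by (simp add: free_gen_eq free_word_carrier)

lemma free_algebra_generated:
  "generated_subalgebra R (free_algebra R B) (free_gen R ` B) = carrier (free_algebra R B)"
    (is "?A = carrier ?F")
proof -
  interpret F: r_algebra R ?F by (rule free_algebra_r_algebra)
  have sub: "free_gen R ` B \<subseteq> carrier ?F"
    using free_gen_carrier by auto
  note A = subringE[OF F.generated_subring[OF sub]]
    and A_smult = F.submoduleE(4)[OF F.generated_submodule[OF sub]]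
  have word: "free_word R w \<in> ?A" if "w \<in> lists B" for w
    using that
  proof (induction w)
    case Nil
    then show ?case
      using A(3) by (simp add: free_algebra_simps)
  next
    case (Cons x w)
    then have "free_gen R x \<otimes>\<^bsub>?F\<^esub> free_word R w \<in> ?A"
      by (intro A(6)) (auto intro: F.generated_subalgebra_incl)
    moreover have "free_gen R x \<otimes>\<^bsub>?F\<^esub> free_word R w = free_word R (x # w)"
      using Cons by (simp add: free_gen_eq free_word_mult)
    ultimately show ?case
      by simp
  qed
  \<comment> \<open>Words are removed from a finite superset of the support. This superset may
    contain words that are not over \<open>B\<close>, but \<open>f\<close> vanishes there.\<close>
  have "f \<in> ?A" if "finite X" "f \<in> carrier ?F" "{w. f w \<noteq> \<zero>} \<subseteq> X" for X f
    using that
  proof (induction X arbitrary: f rule: finite_induct)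
    case empty
    then have "f = \<zero>\<^bsub>?F\<^esub>"
      by (auto simp: free_algebra_simps)
    then show ?case
      using A(2) by simp
  next
    case (insert w X)
    have c: "f v \<in> carrier R" for v
      using insert by (auto simp: free_algebra_carrier)
    have "{v. (f(w := \<zero>)) v \<noteq> \<zero>} \<subseteq> {v. f v \<noteq> \<zero>}"
      by auto
    then have fw: "f(w := \<zero>) \<in> carrier ?F"
      using insert(4) finite_subset[of "{v. (f(w := \<zero>)) v \<noteq> \<zero>}"] by (auto simp: free_algebra_carrier)
    then have 1: "f(w := \<zero>) \<in> ?A"
      using insert(5) by (intro insert.IH[OF fw]) auto
    show ?case
    proof (cases "w \<in> lists B")
      case True
      have "f = f(w := \<zero>) \<oplus>\<^bsub>?F\<^esub> f w \<odot>\<^bsub>?F\<^esub> free_word R w"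
        using c by (intro ext) (simp add: free_algebra_simps free_word_def)
      then show ?thesis
        using A(7) 1 A_smult c word[OF True] by metis
    next
      case False
      then have "f w = \<zero>"
        using insert(4) unfolding free_algebra_carrier by blast
      then have "f(w := \<zero>) = f"
        by (rule fun_upd_idem)
      then show ?thesis
        using 1 by simp
    qed
  qed
  then show ?thesis
    using A(1) by (auto simp: free_algebra_carrier)
qed

end

section \<open>The grading of the partial group algebra\<close>

locale par_presentation = cring R + G: group G
  for R :: "('r, 'p) ring_scheme" (structure) and G :: "('g, 'q) monoid_scheme" +
  fixes rels :: "('r, 'g) eps_relation set"
  assumes rels: "relations_on_eps R G rels"
begin

abbreviation F :: "('r, 'g list \<Rightarrow> 'r) module"
  where "F \<equiv> free_algebra R (carrier G)"

sublocale F: r_algebra R F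
  by (rule free_algebra_r_algebra)

section \<open>Homogeneous elements and components in the free algebra\<close>

definition word_prod :: "'g list \<Rightarrow> 'g"
  where "word_prod w = foldr (\<otimes>\<^bsub>G\<^esub>) w \<one>\<^bsub>G\<^esub>"

definition homogeneous :: "'g \<Rightarrow> ('g list \<Rightarrow> 'r) set"
  where "homogeneous k = {f \<in> carrier F. \<forall>w. f w \<noteq> \<zero> \<longrightarrow> word_prod w = k}"

definition component :: "'g \<Rightarrow> ('g list \<Rightarrow> 'r) \<Rightarrow> 'g list \<Rightarrow> 'r"
  where "component k f = (\<lambda>w. if word_prod w = k then f w else \<zero>)"

lemma word_prod_closed: "w \<in> lists (carrier G) \<Longrightarrow> word_prod w \<in> carrier G"
  by (induction w) (auto simp: word_prod_def)

lemma word_prod_append: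
  "u \<in> lists (carrier G) \<Longrightarrow> v \<in> lists (carrier G) \<Longrightarrow> word_prod (u @ v) = word_prod u \<otimes>\<^bsub>G\<^esub> word_prod v"
  using word_prod_closed by (induction u) (auto simp: word_prod_def G.m_assoc)

lemma F_apply_closed: "f \<in> carrier F \<Longrightarrow> f w \<in> carrier R"
  by (simp add: free_algebra_carrier)

lemma F_apply_nonzero: "f \<in> carrier F \<Longrightarrow> f w \<noteq> \<zero> \<Longrightarrow> w \<in> lists (carrier G)"
  unfolding free_algebra_carrier by blast

lemma homogeneous_F: "f \<in> homogeneous k \<Longrightarrow> f \<in> carrier F"
  by (simp add: homogeneous_def)

lemma homogeneous_submodule: "submodule (homogeneous k) R F"
proof -
  have add: "f \<oplus>\<^bsub>F\<^esub> f' \<in> homogeneous k" if f: "f \<in> homogeneous k" "f' \<in> homogeneous k" for f f'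
  proof -
    have "f w \<noteq> \<zero> \<or> f' w \<noteq> \<zero>" if "f w \<oplus> f' w \<noteq> \<zero>" for w
      using that by auto
    then show ?thesis
      using f by (fastforce simp: homogeneous_def free_algebra_closed free_algebra_simps)
  qed
  have smult: "r \<odot>\<^bsub>F\<^esub> f \<in> homogeneous k" if f: "f \<in> homogeneous k" and r: "r \<in> carrier R" for f r
  proof -
    have "f w \<noteq> \<zero>" if "r \<otimes> f w \<noteq> \<zero>" for w
      using that r by auto
    then show ?thesis
      using f r by (simp add: homogeneous_def free_algebra_closed free_algebra_simps)
  qed
  show ?thesis
  proof (rule F.submoduleI')
    show "\<zero>\<^bsub>F\<^esub> \<in> homogeneous k"
      by (simp add: homogeneous_def free_algebra_simps)
  qed (use add smult homogeneous_F in blast)+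
qed

lemmas homogeneous_closed = F.submoduleE(3-5)[OF homogeneous_submodule]

lemma homogeneous_minus:
  "f \<in> homogeneous k \<Longrightarrow> f' \<in> homogeneous k \<Longrightarrow> f \<ominus>\<^bsub>F\<^esub> f' \<in> homogeneous k"
  by (simp add: F.minus_eq homogeneous_closed)

lemma homogeneous_zero: "\<zero>\<^bsub>F\<^esub> \<in> homogeneous k"
  by (simp add: homogeneous_def free_algebra_simps)

lemma homogeneous_mult:
  assumes f: "f \<in> homogeneous g" and f': "f' \<in> homogeneous h"
  shows "f \<otimes>\<^bsub>F\<^esub> f' \<in> homogeneous (g \<otimes>\<^bsub>G\<^esub> h)"
proof -
  note F = homogeneous_F[OF f] homogeneous_F[OF f']
  have "word_prod w = g \<otimes>\<^bsub>G\<^esub> h" if w: "(f \<otimes>\<^bsub>F\<^esub> f') w \<noteq> \<zero>" for w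
  proof -
    have "\<exists>u v. u @ v = w \<and> f u \<otimes> f' v \<noteq> \<zero>"
    proof (rule ccontr)
      assume "\<not> ?thesis"
      then have "(f \<otimes>\<^bsub>F\<^esub> f') w = \<zero>"
        unfolding free_algebra_simps by (intro add.finprod_one_eqI) auto
      with w show False ..
    qed
    then obtain u v where uv: "u @ v = w" "f u \<otimes> f' v \<noteq> \<zero>"
      by blast
    then have nz: "f u \<noteq> \<zero>" "f' v \<noteq> \<zero>"
      using F by (auto simp: F_apply_closed)
    then have "word_prod w = word_prod u \<otimes>\<^bsub>G\<^esub> word_prod v"
      using uv(1) F F_apply_nonzero word_prod_append by blast
    then show ?thesis
      using nz f f' by (simp add: homogeneous_def)
  qed
  then show ?thesis
    using F by (simp add: homogeneous_def)
qed

lemma homogeneous_one: "\<one>\<^bsub>F\<^esub> \<in> homogeneous \<one>\<^bsub>G\<^esub>"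
  using F.one_closed by (auto simp: homogeneous_def free_algebra_simps free_word_def word_prod_def)

lemma homogeneous_free_gen: "g \<in> carrier G \<Longrightarrow> free_gen R g \<in> homogeneous g"
  using free_gen_carrier[of g] by (auto simp: homogeneous_def free_gen_def word_prod_def)

lemma component_homogeneous: "f \<in> homogeneous h \<Longrightarrow> component k f = (if h = k then f else \<zero>\<^bsub>F\<^esub>)"
proof
  fix w assume "f \<in> homogeneous h"
  then show "component k f w = (if h = k then f else \<zero>\<^bsub>F\<^esub>) w"
    by (cases "f w = \<zero>") (auto simp: component_def homogeneous_def free_algebra_simps)
qed

lemma component_zero: "component k \<zero>\<^bsub>F\<^esub> = \<zero>\<^bsub>F\<^esub>"
  by (rule ext) (simp add: component_def free_algebra_simps)

lemma component_closed:
  assumes "f \<in> carrier F"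
  shows "component k f \<in> carrier F"
proof -
  have "{w. component k f w \<noteq> \<zero>} \<subseteq> {w. f w \<noteq> \<zero>}"
    by (auto simp: component_def)
  then have "finite {w. component k f w \<noteq> \<zero>}"
    using assms finite_subset by (auto simp: free_algebra_carrier)
  then show ?thesis
    using assms unfolding free_algebra_carrier by (simp add: component_def)
qed

lemma component_add:
  assumes "f \<in> carrier F" "f' \<in> carrier F"
  shows "component k (f \<oplus>\<^bsub>F\<^esub> f') = component k f \<oplus>\<^bsub>F\<^esub> component k f'"
  by (auto simp: component_def free_algebra_simps intro!: ext)

lemma component_smult:
  "r \<in> carrier R \<Longrightarrow> component k (r \<odot>\<^bsub>F\<^esub> f) = r \<odot>\<^bsub>F\<^esub> component k f"
  by (auto simp: component_def free_algebra_simps intro!: ext)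

text \<open>A factor of degree g shifts degrees by g, on the side on which it stands. The other
  factor need not be homogeneous, which is what the ideal argument requires.\<close>

lemma
  assumes f: "f \<in> homogeneous g" and f': "f' \<in> carrier F" and g: "g \<in> carrier G" and k: "k \<in> carrier G"
  shows component_mult_left: "component k (f \<otimes>\<^bsub>F\<^esub> f') = f \<otimes>\<^bsub>F\<^esub> component (inv\<^bsub>G\<^esub> g \<otimes>\<^bsub>G\<^esub> k) f'"
    and component_mult_right: "component k (f' \<otimes>\<^bsub>F\<^esub> f) = component (k \<otimes>\<^bsub>G\<^esub> inv\<^bsub>G\<^esub> g) f' \<otimes>\<^bsub>F\<^esub> f"
proof -
  note F = homogeneous_F[OF f] f'
  have c: "f u \<in> carrier R" "f' u \<in> carrier R" "component h f' u \<in> carrier R" for u h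
    using F component_closed[OF f'] by (auto simp: F_apply_closed)
  \<comment> \<open>Degrees multiply only for words over \<open>G\<close>; where both coefficients
    are nonzero the words are of this kind.\<close>
  have left: "f u \<otimes> component (inv\<^bsub>G\<^esub> g \<otimes>\<^bsub>G\<^esub> k) f' v = (if word_prod (u @ v) = k then f u \<otimes> f' v else \<zero>)" for u v
  proof (cases "f u = \<zero> \<or> f' v = \<zero>")
    case True
    then show ?thesis
      using c by (auto simp: component_def)
  next
    case False
    then have uv: "u \<in> lists (carrier G)" "v \<in> lists (carrier G)" "word_prod u = g"
      using F F_apply_nonzero f by (auto simp: homogeneous_def)
    then have "word_prod (u @ v) = g \<otimes>\<^bsub>G\<^esub> word_prod v" "word_prod v \<in> carrier G"
      by (simp_all only: word_prod_append word_prod_closed)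
    then have "word_prod (u @ v) = k \<longleftrightarrow> word_prod v = inv\<^bsub>G\<^esub> g \<otimes>\<^bsub>G\<^esub> k"
      using g k by (metis G.inv_solve_left)
    then show ?thesis
      using c by (simp add: component_def)
  qed
  have right: "component (k \<otimes>\<^bsub>G\<^esub> inv\<^bsub>G\<^esub> g) f' u \<otimes> f v = (if word_prod (u @ v) = k then f' u \<otimes> f v else \<zero>)" for u v
  proof (cases "f' u = \<zero> \<or> f v = \<zero>")
    case True
    then show ?thesis
      using c by (auto simp: component_def)
  next
    case False
    then have uv: "u \<in> lists (carrier G)" "v \<in> lists (carrier G)" "word_prod v = g"
      using F F_apply_nonzero f by (auto simp: homogeneous_def)
    then have "word_prod (u @ v) = word_prod u \<otimes>\<^bsub>G\<^esub> g" "word_prod u \<in> carrier G"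
      by (simp_all only: word_prod_append word_prod_closed)
    then have "word_prod (u @ v) = k \<longleftrightarrow> word_prod u = k \<otimes>\<^bsub>G\<^esub> inv\<^bsub>G\<^esub> g"
      using g k by (metis G.inv_solve_right)
    then show ?thesis
      using c by (simp add: component_def)
  qed
  \<comment> \<open>All splittings of a word have the same product, so the restriction to one degree
    may be moved inside the convolution.\<close>
  have sum: "component k (a \<otimes>\<^bsub>F\<^esub> b) w
      = finsum R (\<lambda>(u, v). if word_prod (u @ v) = k then a u \<otimes> b v else \<zero>) {(u, v). u @ v = w}"
    if "\<And>u. a u \<in> carrier R" "\<And>u. b u \<in> carrier R" for a b w
    unfolding component_def free_algebra_simps
  proof (cases "word_prod w = k")
    case True
    then show "(if word_prod w = k then finsum R (\<lambda>(u, v). a u \<otimes> b v) {(u, v). u @ v = w} else \<zero>)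
      = finsum R (\<lambda>(u, v). if word_prod (u @ v) = k then a u \<otimes> b v else \<zero>) {(u, v). u @ v = w}"
      using that by (simp, intro finsum_cong') auto
  next
    case False
    have "finsum R (\<lambda>(u, v). if word_prod (u @ v) = k then a u \<otimes> b v else \<zero>) {(u, v). u @ v = w} = \<zero>"
      using False by (intro add.finprod_one_eqI) auto
    then show "(if word_prod w = k then finsum R (\<lambda>(u, v). a u \<otimes> b v) {(u, v). u @ v = w} else \<zero>)
      = finsum R (\<lambda>(u, v). if word_prod (u @ v) = k then a u \<otimes> b v else \<zero>) {(u, v). u @ v = w}"
      using False by simp
  qed
  show "component k (f \<otimes>\<^bsub>F\<^esub> f') = f \<otimes>\<^bsub>F\<^esub> component (inv\<^bsub>G\<^esub> g \<otimes>\<^bsub>G\<^esub> k) f'"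
    using sum[of f f'] c by (intro ext) (simp add: free_algebra_simps left)
  show "component k (f' \<otimes>\<^bsub>F\<^esub> f) = component (k \<otimes>\<^bsub>G\<^esub> inv\<^bsub>G\<^esub> g) f' \<otimes>\<^bsub>F\<^esub> f"
    using sum[of f' f] c by (intro ext) (simp add: free_algebra_simps right)
qed

section \<open>The ideal of relations is homogeneous\<close>

definition I :: "('g list \<Rightarrow> 'r) set"
  where "I = Idl\<^bsub>F\<^esub> (par_relators R G rels)"

text \<open>Products and linear combinations of elements of degree e have degree e again. So the
  given relations are homogeneous, whatever they are.\<close>

lemma homogeneous_eval_relation:
  assumes "rel \<in> lists (carrier R \<times> lists (carrier G))"
    and eps: "\<And>g. g \<in> carrier G \<Longrightarrow> \<epsilon> g \<in> homogeneous \<one>\<^bsub>G\<^esub>"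
  shows "eval_relation F \<epsilon> rel \<in> homogeneous \<one>\<^bsub>G\<^esub>"
  using assms(1)
proof (induction rel)
  case Nil
  then show ?case
    by (simp add: eval_relation_def homogeneous_zero)
next
  case (Cons x rel)
  obtain c gs where x: "x = (c, gs)" by (cases x)
  have "foldr (\<lambda>g p. \<epsilon> g \<otimes>\<^bsub>F\<^esub> p) gs \<one>\<^bsub>F\<^esub> \<in> homogeneous \<one>\<^bsub>G\<^esub>" if "gs \<in> lists (carrier G)" for gs
    using that
  proof (induction gs)
    case (Cons g gs)
    then show ?case
      using homogeneous_mult[OF eps, of g _ "\<one>\<^bsub>G\<^esub>"] by simp
  qed (simp add: homogeneous_one)
  then show ?case
    using Cons x by (simp add: eval_relation_def homogeneous_closed)
qed

text \<open>Both sides of (ii) have degree g^-1 g h = h, and both sides of (iii) have degree g h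
  h^-1; the remaining relators have degree e.\<close>

lemma relators_homogeneous:
  assumes "x \<in> par_relators R G rels"
  shows "\<exists>k\<in>carrier G. x \<in> homogeneous k"
proof -
  let ?b = "free_gen R"
  note b = homogeneous_free_gen
  have eps: "?b g \<otimes>\<^bsub>F\<^esub> ?b (inv\<^bsub>G\<^esub> g) \<in> homogeneous \<one>\<^bsub>G\<^esub>" if "g \<in> carrier G" for g
    using that homogeneous_mult[OF b b, of g "inv\<^bsub>G\<^esub> g"] by simp
  consider "x = ?b \<one>\<^bsub>G\<^esub> \<ominus>\<^bsub>F\<^esub> \<one>\<^bsub>F\<^esub>"
    | g h where "g \<in> carrier G" "h \<in> carrier G"
      "x = (?b (inv\<^bsub>G\<^esub> g) \<otimes>\<^bsub>F\<^esub> ?b g \<otimes>\<^bsub>F\<^esub> ?b h) \<ominus>\<^bsub>F\<^esub> (?b (inv\<^bsub>G\<^esub> g) \<otimes>\<^bsub>F\<^esub> ?b (g \<otimes>\<^bsub>G\<^esub> h))"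
    | g h where "g \<in> carrier G" "h \<in> carrier G"
      "x = (?b g \<otimes>\<^bsub>F\<^esub> ?b h \<otimes>\<^bsub>F\<^esub> ?b (inv\<^bsub>G\<^esub> h)) \<ominus>\<^bsub>F\<^esub> (?b (g \<otimes>\<^bsub>G\<^esub> h) \<otimes>\<^bsub>F\<^esub> ?b (inv\<^bsub>G\<^esub> h))"
    | rel where "rel \<in> rels" "x = eval_relation F (\<lambda>g. ?b g \<otimes>\<^bsub>F\<^esub> ?b (inv\<^bsub>G\<^esub> g)) rel"
    using assms unfolding par_relators_def Let_def by blast
  then show ?thesis
  proof cases
    case 1
    then show ?thesis
      using homogeneous_minus[OF b homogeneous_one] by auto
  next
    case (2 g h)
    have "?b (inv\<^bsub>G\<^esub> g) \<otimes>\<^bsub>F\<^esub> ?b g \<otimes>\<^bsub>F\<^esub> ?b h \<in> homogeneous (inv\<^bsub>G\<^esub> g \<otimes>\<^bsub>G\<^esub> g \<otimes>\<^bsub>G\<^esub> h)"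
      "?b (inv\<^bsub>G\<^esub> g) \<otimes>\<^bsub>F\<^esub> ?b (g \<otimes>\<^bsub>G\<^esub> h) \<in> homogeneous (inv\<^bsub>G\<^esub> g \<otimes>\<^bsub>G\<^esub> (g \<otimes>\<^bsub>G\<^esub> h))"
      using 2 by (intro homogeneous_mult b; simp)+
    then show ?thesis
      using 2 homogeneous_minus by (intro bexI[of _ h]) (simp_all add: G.m_assoc[symmetric])
  next
    case (3 g h)
    have "?b g \<otimes>\<^bsub>F\<^esub> ?b h \<otimes>\<^bsub>F\<^esub> ?b (inv\<^bsub>G\<^esub> h) \<in> homogeneous (g \<otimes>\<^bsub>G\<^esub> h \<otimes>\<^bsub>G\<^esub> inv\<^bsub>G\<^esub> h)"
      "?b (g \<otimes>\<^bsub>G\<^esub> h) \<otimes>\<^bsub>F\<^esub> ?b (inv\<^bsub>G\<^esub> h) \<in> homogeneous (g \<otimes>\<^bsub>G\<^esub> h \<otimes>\<^bsub>G\<^esub> inv\<^bsub>G\<^esub> h)"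
      using 3 by (intro homogeneous_mult b; simp)+
    then show ?thesis
      using 3 homogeneous_minus by (intro bexI[of _ "g \<otimes>\<^bsub>G\<^esub> h \<otimes>\<^bsub>G\<^esub> inv\<^bsub>G\<^esub> h"]) simp_all
  next
    case (4 rel)
    then have "rel \<in> lists (carrier R \<times> lists (carrier G))"
      using rels by (auto simp: relations_on_eps_def)
    then have "x \<in> homogeneous \<one>\<^bsub>G\<^esub>"
      unfolding 4 by (rule homogeneous_eval_relation[OF _ eps])
    then show ?thesis
      by blast
  qed
qed

lemma relators_F: "par_relators R G rels \<subseteq> carrier F"
  using relators_homogeneous homogeneous_F by blast

lemma I_ideal: "ideal I F"
  unfolding I_def by (rule F.genideal_ideal[OF relators_F])

lemma relators_I: "x \<in> par_relators R G rels \<Longrightarrow> x \<in> I"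
  using F.genideal_self[OF relators_F] by (auto simp: I_def)

text \<open>The elements of \<open>I\<close> all of whose components lie in \<open>I\<close> form an ideal, which contains the relators
  because these are homogeneous.\<close>

lemma component_I:
  assumes "f \<in> I" "k \<in> carrier G"
  shows "component k f \<in> I"
proof -
  interpret I: ideal I F by (rule I_ideal)
  define J where "J = {f \<in> I. \<forall>k\<in>carrier G. component k f \<in> I}"
  have J_I: "f \<in> I" and J_F: "f \<in> carrier F" and J_c: "k \<in> carrier G \<Longrightarrow> component k f \<in> I" if "f \<in> J" for f k
    using that I.a_subset by (auto simp: J_def)
  have J_add: "f \<oplus>\<^bsub>F\<^esub> f' \<in> J" if "f \<in> J" "f' \<in> J" for f f'
    using that J_F by (simp add: J_def component_add I.a_closed)
  have J_smult: "r \<odot>\<^bsub>F\<^esub> f \<in> J" if "f \<in> J" "r \<in> carrier R" for f r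
    using that by (simp add: J_def component_smult F.ideal_smult_closed[OF I_ideal])
  \<comment> \<open>The induction is on the multiplier, because the degree shift is available for
    generators only. The claim quantifies over \<open>f\<close>, since for a product the hypothesis
    is applied to an element of \<open>J\<close> that is already a multiple.\<close>
  have J_mult: "\<forall>f\<in>J. a \<otimes>\<^bsub>F\<^esub> f \<in> J \<and> f \<otimes>\<^bsub>F\<^esub> a \<in> J" if "a \<in> carrier F" for a
  proof -
    have gens: "free_gen R ` carrier G \<subseteq> carrier F"
      by (auto intro: free_gen_carrier)
    note [simp] = free_algebra_generated[of "carrier G"]
    have "a \<in> generated_subalgebra R F (free_gen R ` carrier G)"
      using that by simp
    from this gens show ?thesis
    proof (induction rule: F.generated_subalgebra_induct)
      case (gen s)
      then obtain g where g: "g \<in> carrier G" "s = free_gen R g" by auto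
      note b = homogeneous_free_gen[OF g(1)]
      have s: "s \<in> carrier F"
        using homogeneous_F[OF b] g by simp
      show ?case
      proof
        fix f assume f: "f \<in> J"
        have "component k (s \<otimes>\<^bsub>F\<^esub> f) \<in> I" "component k (f \<otimes>\<^bsub>F\<^esub> s) \<in> I" if k: "k \<in> carrier G" for k
          using component_mult_left[OF b J_F[OF f] g(1) k] component_mult_right[OF b J_F[OF f] g(1) k]
            J_c[OF f] s g k by (simp_all add: I.I_l_closed I.I_r_closed)
        then show "s \<otimes>\<^bsub>F\<^esub> f \<in> J \<and> f \<otimes>\<^bsub>F\<^esub> s \<in> J"
          using J_I[OF f] s by (simp add: J_def I.I_l_closed I.I_r_closed)
      qed
    next
      case one
      then show ?case
        using J_F by simp
    next
      case (add x y)
      then show ?case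
        using J_F J_add by (simp add: F.l_distr F.r_distr)
    next
      case (mult x y)
      show ?case
      proof
        fix f assume f: "f \<in> J"
        have "x \<otimes>\<^bsub>F\<^esub> (y \<otimes>\<^bsub>F\<^esub> f) \<in> J" "(f \<otimes>\<^bsub>F\<^esub> x) \<otimes>\<^bsub>F\<^esub> y \<in> J"
          using mult f by blast+
        then show "x \<otimes>\<^bsub>F\<^esub> y \<otimes>\<^bsub>F\<^esub> f \<in> J \<and> f \<otimes>\<^bsub>F\<^esub> (x \<otimes>\<^bsub>F\<^esub> y) \<in> J"
          using mult(1,2) J_F[OF f] by (simp add: F.m_assoc)
      qed
    next
      case (smult r x)
      then show ?case
        using J_F J_smult by (simp add: F.smult_mult_left F.smult_mult_right)
    qed
  qed
  have J_zero: "\<zero>\<^bsub>F\<^esub> \<in> J"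
    using I.zero_closed
    by (simp add: J_def component_zero)
  have "ideal J F"
  proof (rule idealI[OF F.ring_axioms])
    have "submodule J R F"
      by (rule F.submoduleI') (use J_F J_zero J_add J_smult in blast)+
    then show "subgroup J (add_monoid F)"
      by (simp add: submodule_def)
  qed (use J_mult in auto)
  moreover have "par_relators R G rels \<subseteq> J"
  proof
    fix x assume x: "x \<in> par_relators R G rels"
    then obtain h where "x \<in> homogeneous h"
      using relators_homogeneous by blast
    then show "x \<in> J"
      using relators_I[OF x] I.zero_closed by (simp add: J_def component_homogeneous)
  qed
  ultimately have "I \<subseteq> J"
    unfolding I_def by (rule F.genideal_minimal)
  then show ?thesis
    using assms J_c by blast
qed

section \<open>The quotient \<open>R_par\<close> and its grading\<close>

abbreviation proj :: "('g list \<Rightarrow> 'r) \<Rightarrow> ('g list \<Rightarrow> 'r) set"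
  where "proj f \<equiv> I +>\<^bsub>F\<^esub> f"

abbreviation P :: "('r, ('g list \<Rightarrow> 'r) set) module"
  where "P \<equiv> R_par R G rels"

lemma P_eq: "P = quotient_algebra F I"
  by (simp add: R_par_def I_def)

lemma par_gen_eq: "par_gen R G rels g = proj (free_gen R g)"
  by (simp add: par_gen_def I_def)

lemmas proj_simps =
  F.quotient_algebra_zero[OF I_ideal, folded P_eq]
  F.quotient_algebra_one[OF I_ideal, folded P_eq]
  F.quotient_algebra_add[OF I_ideal, folded P_eq]
  F.quotient_algebra_mult[OF I_ideal, folded P_eq]
  F.quotient_algebra_smult[OF I_ideal, folded P_eq]

lemma P_carrier: "carrier P = proj ` carrier F"
  by (simp add: P_eq F.quotient_algebra_carrier[OF I_ideal])

lemma proj_eq_iff: "f \<in> carrier F \<Longrightarrow> f' \<in> carrier F \<Longrightarrow> proj f = proj f' \<longleftrightarrow> f \<ominus>\<^bsub>F\<^esub> f' \<in> I"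
  by (simp add: F.quotient_eq_iff_same_a_r_cos[OF I_ideal])

lemma proj_eq_zero_iff: "f \<in> carrier F \<Longrightarrow> proj f = \<zero>\<^bsub>P\<^esub> \<longleftrightarrow> f \<in> I"
  by (simp add: proj_simps proj_eq_iff F.minus_eq)

sublocale P: r_algebra R P
  unfolding P_eq by (rule F.r_algebra_quotient[OF I_ideal])

lemma par_gen_generated: "generated_subalgebra R P (par_gen R G rels ` carrier G) = carrier P"
    (is "?A = _")
proof -
  have gens: "free_gen R ` carrier G \<subseteq> carrier F"
    by (auto intro: free_gen_carrier)
  have sub: "par_gen R G rels ` carrier G \<subseteq> carrier P"
    using gens by (auto simp: P_carrier par_gen_eq)
  note A = subringE[OF P.generated_subring[OF sub]] P.submoduleE(4)[OF P.generated_submodule[OF sub]]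
  have c: "f \<in> carrier F" if "f \<in> generated_subalgebra R F (free_gen R ` carrier G)" for f
    using that by (simp add: free_algebra_generated)
  have "proj f \<in> ?A" if "f \<in> carrier F" for f
  proof -
    have "f \<in> generated_subalgebra R F (free_gen R ` carrier G)"
      using that by (simp add: free_algebra_generated)
    from this gens show ?thesis
    proof (induction rule: F.generated_subalgebra_induct)
      case (gen s)
      then show ?case
        by (auto simp: par_gen_eq[symmetric] intro: P.generated_subalgebra_incl)
    next
      case one
      then show ?case
        using A(3) by (simp add: proj_simps)
    next
      case (add x y)
      then show ?case
        using A(7)[of "proj x" "proj y"] c by (simp add: proj_simps)
    next
      case (mult x y)
      then show ?case
        using A(6)[of "proj x" "proj y"] c by (simp add: proj_simps)
    next
      case (smult r x)
      then show ?case
        using A(8)[of r "proj x"] c by (simp add: proj_simps)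
    qed
  qed
  then show ?thesis
    using A(1) by (auto simp: P_carrier)
qed

definition H :: "'g \<Rightarrow> ('g list \<Rightarrow> 'r) set set"
  where "H k = proj ` homogeneous k"

lemma H_submodule: "submodule (H k) R P"
proof (rule P.submoduleI')
  show "r \<odot>\<^bsub>P\<^esub> x \<in> H k" if r: "r \<in> carrier R" and x: "x \<in> H k" for r x
  proof -
    obtain f where "f \<in> homogeneous k" "x = proj f"
      using x by (auto simp: H_def)
    then show ?thesis
      using r homogeneous_F homogeneous_closed(2)[of r f k] by (auto simp: H_def proj_simps)
  qed
  show "H k \<subseteq> carrier P"
    using homogeneous_F by (auto simp: H_def P_carrier)
  show "\<zero>\<^bsub>P\<^esub> \<in> H k"
    using homogeneous_zero by (auto simp: H_def proj_simps)
  show "x \<oplus>\<^bsub>P\<^esub> y \<in> H k" if xy: "x \<in> H k" "y \<in> H k" for x y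
  proof -
    obtain f f' where "f \<in> homogeneous k" "x = proj f" "f' \<in> homogeneous k" "y = proj f'"
      using xy by (auto simp: H_def)
    then show ?thesis
      using homogeneous_F homogeneous_closed(3)[of f k f'] by (auto simp: H_def proj_simps)
  qed
qed

lemma H_mult:
  assumes "x \<in> H g" "y \<in> H h"
  shows "x \<otimes>\<^bsub>P\<^esub> y \<in> H (g \<otimes>\<^bsub>G\<^esub> h)"
proof -
  obtain f f' where "f \<in> homogeneous g" "x = proj f" "f' \<in> homogeneous h" "y = proj f'"
    using assms by (auto simp: H_def)
  then show ?thesis
    using homogeneous_F homogeneous_mult[of f g f' h] by (auto simp: H_def proj_simps)
qed

text \<open>The whole sum is lifted to one element of the free algebra whose components lift the
  summands. If the sum vanishes, the lift lies in \<open>I\<close>, and by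
  \<open>component_I\<close> so does each component.\<close>

lemma H_independent:
  assumes "finite K" "K \<subseteq> carrier G" "\<And>k. k \<in> K \<Longrightarrow> x k \<in> H k" "finsum P x K = \<zero>\<^bsub>P\<^esub>" "k \<in> K"
  shows "x k = \<zero>\<^bsub>P\<^esub>"
proof -
  \<comment> \<open>The clause on degrees outside \<open>K\<close> serves the induction: a summand
    of a new degree must meet a zero component of the previous lift.\<close>
  have "\<exists>f\<in>carrier F. finsum P x K = proj f \<and> (\<forall>k\<in>K. proj (component k f) = x k)
      \<and> (\<forall>k. k \<notin> K \<longrightarrow> component k f = \<zero>\<^bsub>F\<^esub>)"
    using assms(1,2,3)
  proof (induction K rule: finite_induct)
    case empty
    show ?case
      by (rule bexI[of _ "\<zero>\<^bsub>F\<^esub>"])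
        (auto simp: proj_simps P.finsum_empty component_zero)
  next
    case (insert h K)
    then obtain f where f: "f \<in> carrier F" "finsum P x K = proj f" "\<And>k. k \<in> K \<Longrightarrow> proj (component k f) = x k"
      "\<And>k. k \<notin> K \<Longrightarrow> component k f = \<zero>\<^bsub>F\<^esub>"
      by auto
    obtain f' where f': "f' \<in> homogeneous h" "x h = proj f'"
      using insert(5)[of h] unfolding H_def by blast
    have f'F: "f' \<in> carrier F"
      using f'(1) by (rule homogeneous_F)
    have xP: "x k \<in> carrier P" if "k \<in> insert h K" for k
      using insert(5)[OF that] P.submoduleE(1)[OF H_submodule] by auto
    have "finsum P x (insert h K) = x h \<oplus>\<^bsub>P\<^esub> finsum P x K"
      using insert(1,2) xP by (intro P.finsum_insert) auto
    then have "finsum P x (insert h K) = proj (f' \<oplus>\<^bsub>F\<^esub> f)"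
      using f f' f'F by (simp add: proj_simps)
    moreover have "component k (f' \<oplus>\<^bsub>F\<^esub> f) = (if k = h then f' else component k f)" for k
      using f f'F insert(2) component_closed[OF f(1)]
      by (auto simp: component_add component_homogeneous[OF f'(1)])
    ultimately show ?case
      using f f' f'F insert(2) by (intro bexI[of _ "f' \<oplus>\<^bsub>F\<^esub> f"]) auto
  qed
  then obtain f where f: "f \<in> carrier F" "finsum P x K = proj f" "\<And>k. k \<in> K \<Longrightarrow> proj (component k f) = x k"
    by auto
  then have "f \<in> I"
    using proj_eq_zero_iff[OF f(1)] assms(4) by simp
  then have "component k f \<in> I"
    using assms by (intro component_I) auto
  then show ?thesis
    using f assms(5) component_closed[OF f(1)] by (simp add: proj_eq_zero_iff flip: f(3))
qed

sublocale par: graded_partial_representation R P G "par_gen R G rels" H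
proof (intro graded_partial_representation.intro partial_representation.intro
    graded_partial_representation_axioms.intro partial_representation_axioms.intro
    P.r_algebra_axioms G.group_axioms)
  let ?b = "free_gen R"
  have b: "?b g \<in> carrier F" if "g \<in> carrier G" for g
    using that by (rule free_gen_carrier)
  \<comment> \<open>Each defining relation holds in the quotient because the difference of its sides
    is a relator.\<close>
  have rel: "proj f = proj f'" if "f \<ominus>\<^bsub>F\<^esub> f' \<in> par_relators R G rels" "f \<in> carrier F" "f' \<in> carrier F" for f f'
    using that relators_I by (simp add: proj_eq_iff)
  show "par_gen R G rels g \<in> carrier P" if "g \<in> carrier G" for g
    using b[OF that] by (auto simp: par_gen_eq P_carrier)
  show "par_gen R G rels \<one>\<^bsub>G\<^esub> = \<one>\<^bsub>P\<^esub>"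
    unfolding par_gen_eq proj_simps
    by (rule rel) (auto simp: b par_relators_def Let_def)
  show "par_gen R G rels (inv\<^bsub>G\<^esub> g) \<otimes>\<^bsub>P\<^esub> par_gen R G rels g \<otimes>\<^bsub>P\<^esub> par_gen R G rels h
      = par_gen R G rels (inv\<^bsub>G\<^esub> g) \<otimes>\<^bsub>P\<^esub> par_gen R G rels (g \<otimes>\<^bsub>G\<^esub> h)"
    if gh: "g \<in> carrier G" "h \<in> carrier G" for g h
  proof -
    have "proj (?b (inv\<^bsub>G\<^esub> g) \<otimes>\<^bsub>F\<^esub> ?b g \<otimes>\<^bsub>F\<^esub> ?b h) = proj (?b (inv\<^bsub>G\<^esub> g) \<otimes>\<^bsub>F\<^esub> ?b (g \<otimes>\<^bsub>G\<^esub> h))"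
      using gh b by (intro rel) (auto simp: par_relators_def Let_def)
    then show ?thesis
      using gh by (simp add: par_gen_eq proj_simps b)
  qed
  show "par_gen R G rels g \<otimes>\<^bsub>P\<^esub> par_gen R G rels h \<otimes>\<^bsub>P\<^esub> par_gen R G rels (inv\<^bsub>G\<^esub> h)
      = par_gen R G rels (g \<otimes>\<^bsub>G\<^esub> h) \<otimes>\<^bsub>P\<^esub> par_gen R G rels (inv\<^bsub>G\<^esub> h)"
    if gh: "g \<in> carrier G" "h \<in> carrier G" for g h
  proof -
    have "proj (?b g \<otimes>\<^bsub>F\<^esub> ?b h \<otimes>\<^bsub>F\<^esub> ?b (inv\<^bsub>G\<^esub> h)) = proj (?b (g \<otimes>\<^bsub>G\<^esub> h) \<otimes>\<^bsub>F\<^esub> ?b (inv\<^bsub>G\<^esub> h))"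
      using gh b by (intro rel) (auto simp: par_relators_def Let_def)
    then show ?thesis
      using gh by (simp add: par_gen_eq proj_simps b)
  qed
  show "generated_subalgebra R P (par_gen R G rels ` carrier G) = carrier P"
    by (rule par_gen_generated)
  show "submodule (H k) R P" if "k \<in> carrier G" for k
    by (rule H_submodule)
  show "par_gen R G rels g \<in> H g" if "g \<in> carrier G" for g
    using homogeneous_free_gen[OF that] by (auto simp: H_def par_gen_eq)
qed (use H_mult H_independent in blast)+

text \<open>This and the next three equations translate the abstract theory into the constants of
  the theorem.\<close>

lemma par_eps_eq: "par.eps = par_eps R G rels"
  by (intro ext) (simp add: par.eps_def par_eps_def)

lemma A_par_eq: "par.EA = A_par R G rels"
  by (simp add: A_par_def par.E_def par_eps_eq)

lemma par_ideal_eq: "par.D = par_ideal R G rels"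
  by (intro ext) (simp add: par.D_def par_ideal_def par_eps_eq flip: A_par_eq)

lemma par_theta_eq: "par.theta_maps = par_theta R G rels"
  by (intro ext) (simp add: par.theta_maps_def par_theta_def par_eps_eq par_ideal_eq flip: A_par_eq)

end

text \<open>The first conjunct provides the maps theta_g, so the quantification over all families
  theta is not vacuous; the last one makes every homomorphism with the prescribed values an
  isomorphism.\<close>

theorem proposition2p10:
  fixes R :: "('r, 'p) ring_scheme" and G :: "('g, 'q) monoid_scheme"
    and rels :: "('r, 'g) eps_relation set"
  assumes "cring R" and "\<one>\<^bsub>R\<^esub> \<noteq> \<zero>\<^bsub>R\<^esub>"
    and "group G"
    and "relations_on_eps R G rels"
  shows "(\<forall>g\<in>carrier G. \<exists>!\<phi>. \<phi> \<in> par_theta R G rels g \<inter> extensional (par_ideal R G rels (inv\<^bsub>G\<^esub> g)))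
    \<and> (\<forall>\<theta>. (\<forall>g\<in>carrier G. \<theta> g \<in> par_theta R G rels g) \<longrightarrow>
          partial_action R G (A_par R G rels) (par_ideal R G rels) \<theta>
        \<and> (let S = partial_skew_group_ring G (A_par R G rels) (par_ideal R G rels) \<theta> in
             (\<exists>!\<Phi>. \<Phi> \<in> unital_alg_hom R (R_par R G rels) S \<inter> extensional (carrier (R_par R G rels))
                 \<and> (\<forall>g\<in>carrier G. \<Phi> (par_gen R G rels g) = skew_elem (A_par R G rels) (par_eps R G rels g) g))
           \<and> (\<forall>\<Phi> \<in> unital_alg_hom R (R_par R G rels) S.
                 (\<forall>g\<in>carrier G. \<Phi> (par_gen R G rels g) = skew_elem (A_par R G rels) (par_eps R G rels g) g)
                 \<longrightarrow> \<Phi> \<in> unital_alg_iso R (R_par R G rels) S)))"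
proof -
  interpret par_presentation R G rels
    using assms by (simp add: par_presentation_def par_presentation_axioms_def)
  note eqs = A_par_eq par_ideal_eq par_theta_eq par_eps_eq
  \<comment> \<open>This discharges the assumption on theta under which the skew group ring was
    studied.\<close>
  have \<theta>: "\<theta> g x = par.conjugate g x"
    if "\<forall>g\<in>carrier G. \<theta> g \<in> par_theta R G rels g" "g \<in> carrier G" "x \<in> par.D (inv\<^bsub>G\<^esub> g)" for \<theta> g x
    using that by (intro par.theta_maps_conjugate) (simp_all add: eqs)
  show ?thesis
    unfolding Let_def
  proof (intro conjI allI impI ballI)
    show "\<exists>!\<phi>. \<phi> \<in> par_theta R G rels g \<inter> extensional (par_ideal R G rels (inv\<^bsub>G\<^esub> g))"
      if "g \<in> carrier G" for g
      using par.theta_maps_ex1[OF that] unfolding eqs .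
  next
    fix \<theta> assume th: "\<forall>g\<in>carrier G. \<theta> g \<in> par_theta R G rels g"
    show "partial_action R G (A_par R G rels) (par_ideal R G rels) \<theta>"
      using par.partial_action_conjugate[of \<theta>, OF \<theta>[OF th]] unfolding eqs .
    let ?S = "partial_skew_group_ring G (A_par R G rels) (par_ideal R G rels) \<theta>"
    show "\<exists>!\<Phi>. \<Phi> \<in> unital_alg_hom R P ?S \<inter> extensional (carrier P)
        \<and> (\<forall>g\<in>carrier G. \<Phi> (par_gen R G rels g) = skew_elem (A_par R G rels) (par_eps R G rels g) g)"
      using par.skew_hom_ex1[of \<theta>, OF \<theta>[OF th]] unfolding eqs .
    fix \<Phi> assume \<Phi>: "\<Phi> \<in> unital_alg_hom R P ?S"
      "\<forall>g\<in>carrier G. \<Phi> (par_gen R G rels g) = skew_elem (A_par R G rels) (par_eps R G rels g) g"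
    then show "\<Phi> \<in> unital_alg_iso R P ?S"
      using par.skew_hom_iso[of \<theta>, OF \<theta>[OF th], of \<Phi>] unfolding eqs by blast
  qed
qed

end
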